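(* Consider $\mathrm{U}(2)$ with the $\mathcal{S}$-structure $(\phi,\xi_1,\xi_2,\eta_1,\eta_2,g)$ and the connection $\nabla$ described in the context. The holonomy algebra $\mathfrak{hol}(\nabla)$ is isomorphic to $\mathfrak{so}(2)\cong\mathfrak{u}(1)$, and the curvature tensor $R^{\nabla}$ is $\nabla$-parallel.
   Context: Let $E_{ij}$ be the elementary $2\times2$ matrices. On the Lie group $\mathrm{U}(2)$ take the left-invariant vector fields with values at the identity $X_{12}=E_{12}-E_{21}$, $Y_{12}=\sqrt{-1}(E_{12}+E_{21})$, $\xi_1=\sqrt{-1}E_{11}$, $\xi_2=-\sqrt{-1}E_{22}$; their brackets are $[X_{12},Y_{12}]=2(\xi_1+\xi_2)$, $[X_{12},\xi_i]=-Y_{12}$, $[Y_{12},\xi_i]=X_{12}$, $[\xi_1,\xi_2]=0$. Let $g$ be the left-invariant Riemannian metric making $\{X_{12},Y_{12},\xi_1,\xi_2\}$ orthonormal, $\eta_i=g(\xi_i,\cdot)$, and let $\phi$ be the left-invariant endomorphism with $\phi(X_{12})=Y_{12}$, $\phi(Y_{12})=-X_{12}$, $\phi(\xi_1)=\phi(\xi_2)=0$. Put $F(X,Y)=g(X,\phi Y)$. This is an $\mathcal{S}$-manifold of CR-codimension 2: a normal metric $f$-structure with $2F=d\eta_1=d\eta_2$, where $d\eta(X,Y)=X\eta(Y)-Y\eta(X)-\eta([X,Y])$. Let $\nabla=\nabla^g+\frac12T$, i.e. $g(\nabla_XY,Z)=g(\nabla^g_XY,Z)+\frac12T(X,Y,Z)$,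 where $\nabla^g$ is the Levi-Civita connection and $T=2(\eta_1+\eta_2)\wedge F$, with $(\eta\wedge F)(X,Y,Z)=\eta(X)F(Y,Z)-\eta(Y)F(X,Z)+\eta(Z)F(X,Y)$. This is the unique connection with totally skew-symmetric torsion making $g,\phi,\xi_i,\eta_i$ parallel. $R^\nabla(X,Y)Z=\nabla_X\nabla_YZ-\nabla_Y\nabla_XZ-\nabla_{[X,Y]}Z$. *)

theory Defs
  imports "HOL-Analysis.Analysis"
begin

section \<open>The group U(2), its Lie algebra and smooth maps\<close>

type_synonym mat2 = "complex^2^2"

definition herm_adj :: "complex^'n^'m \<Rightarrow> complex^'m^'n" where
  "herm_adj A = (\<chi> i j. cnj (A $ j $ i))"

definition U2 :: "mat2 set" where
  "U2 = {p. herm_adj p ** p = mat 1}"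

definition u_alg :: "(complex^'n^'n) set" where
  "u_alg = {A. herm_adj A = - A}"

definition so_alg :: "(real^'n^'n) set" where
  "so_alg = {A. transpose A = - A}"

text \<open>U(2) is treated as an embedded submanifold of the matrix space: its tangent space at \<open>p\<close>
  is the left translate of u(2), and a map on U(2) is smooth if near every point it is
  the restriction of a smooth map on an open set of matrices. The relevant functions are total on
  the matrix space; only their values on U(2) matter.\<close>

definition tangent :: "mat2 \<Rightarrow> mat2 set" where
  "tangent p = {p ** A |A. A \<in> u_alg}"

primrec Ck_on :: "nat \<Rightarrow> 'a::real_normed_vector set \<Rightarrow> ('a \<Rightarrow> 'b::real_normed_vector) \<Rightarrow> bool" where
  "Ck_on 0 S f \<longleftrightarrow> continuous_on S f"
| "Ck_on (Suc k) S f \<longleftrightarrow>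
     (\<forall>x\<in>S. f differentiable (at x)) \<and> (\<forall>v. Ck_on k S (\<lambda>x. frechet_derivative f (at x) v))"

definition smooth_U2 :: "(mat2 \<Rightarrow> 'b::real_normed_vector) \<Rightarrow> bool" where
  "smooth_U2 f \<longleftrightarrow> (\<forall>p\<in>U2. \<exists>S h. open S \<and> p \<in> S \<and> (\<forall>k. Ck_on k S h) \<and> (\<forall>q\<in>S \<inter> U2. f q = h q))"

definition vector_field :: "(mat2 \<Rightarrow> mat2) \<Rightarrow> bool" where
  "vector_field X \<longleftrightarrow> smooth_U2 X \<and> (\<forall>p\<in>U2. X p \<in> tangent p)"

text \<open>The differential at \<open>p\<close> of a map on U(2), applied to a tangent vector \<open>v\<close>. The Frechet
  derivative within U(2) is only determined in tangent directions, the only ones in which it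
  is used.\<close>

definition ddir :: "(mat2 \<Rightarrow> 'b::real_normed_vector) \<Rightarrow> mat2 \<Rightarrow> mat2 \<Rightarrow> 'b" where
  "ddir f p v = frechet_derivative f (at p within U2) v"

text \<open>Lie bracket, with the sign \<open>[X,Y]f = X(Yf) - Y(Xf)\<close>.\<close>

definition bracket :: "(mat2 \<Rightarrow> mat2) \<Rightarrow> (mat2 \<Rightarrow> mat2) \<Rightarrow> mat2 \<Rightarrow> mat2" where
  "bracket X Y p = ddir Y p (X p) - ddir X p (Y p)"


section \<open>The left-invariant structure\<close>

definition linv :: "mat2 \<Rightarrow> mat2 \<Rightarrow> mat2" where
  "linv A p = p ** A"

definition elem :: "2 \<Rightarrow> 2 \<Rightarrow> mat2" where
  "elem i j = (\<chi> k l. if k = i \<and> l = j then 1 else 0)"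

definition cscale :: "complex \<Rightarrow> mat2 \<Rightarrow> mat2" where
  "cscale c A = (\<chi> i j. c * A $ i $ j)"

definition X12 :: mat2 where "X12 = elem 1 2 - elem 2 1"
definition Y12 :: mat2 where "Y12 = cscale \<i> (elem 1 2 + elem 2 1)"
definition xi1 :: mat2 where "xi1 = cscale \<i> (elem 1 1)"
definition xi2 :: mat2 where "xi2 = - cscale \<i> (elem 2 2)"

definition frame :: "mat2 set" where
  "frame = {X12, Y12, xi1, xi2}"

text \<open>On u(2) this is the inner product with orthonormal basis \<open>X12, Y12, xi1, xi2\<close>: the
  four factors are the coordinates with respect to this basis, see \<open>u_alg_expansion\<close> and
  \<open>lmetric_orthonormal\<close> below.\<close>

definition ip_e :: "mat2 \<Rightarrow> mat2 \<Rightarrow> real" where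
  "ip_e A B = Re (A $ 1 $ 2) * Re (B $ 1 $ 2) + Im (A $ 1 $ 2) * Im (B $ 1 $ 2)
     + Im (A $ 1 $ 1) * Im (B $ 1 $ 1) + Im (A $ 2 $ 2) * Im (B $ 2 $ 2)"

definition lmetric :: "mat2 \<Rightarrow> mat2 \<Rightarrow> mat2 \<Rightarrow> real" where
  "lmetric p v w = ip_e (herm_adj p ** v) (herm_adj p ** w)"

definition eta1 :: "mat2 \<Rightarrow> mat2 \<Rightarrow> real" where "eta1 p v = lmetric p (linv xi1 p) v"
definition eta2 :: "mat2 \<Rightarrow> mat2 \<Rightarrow> real" where "eta2 p v = lmetric p (linv xi2 p) v"

definition phi :: "mat2 \<Rightarrow> mat2 \<Rightarrow> mat2" where
  "phi p v = lmetric p (linv X12 p) v *\<^sub>R linv Y12 p - lmetric p (linv Y12 p) v *\<^sub>R linv X12 p"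

definition F :: "mat2 \<Rightarrow> mat2 \<Rightarrow> mat2 \<Rightarrow> real" where
  "F p v w = lmetric p v (phi p w)"

definition wedge :: "(mat2 \<Rightarrow> real) \<Rightarrow> (mat2 \<Rightarrow> mat2 \<Rightarrow> real) \<Rightarrow> mat2 \<Rightarrow> mat2 \<Rightarrow> mat2 \<Rightarrow> real" where
  "wedge \<eta> \<omega> u v w = \<eta> u * \<omega> v w - \<eta> v * \<omega> u w + \<eta> w * \<omega> u v"

definition torsion_form :: "mat2 \<Rightarrow> mat2 \<Rightarrow> mat2 \<Rightarrow> mat2 \<Rightarrow> real" where
  "torsion_form p u v w = 2 * wedge (\<lambda>x. eta1 p x + eta2 p x) (F p) u v w"


section \<open>Affine connections\<close>

definition affine_connection :: "((mat2 \<Rightarrow> mat2) \<Rightarrow> (mat2 \<Rightarrow> mat2) \<Rightarrow> mat2 \<Rightarrow> mat2) \<Rightarrow> bool" where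
  "affine_connection D \<longleftrightarrow>
     (\<forall>X Y. vector_field X \<longrightarrow> vector_field Y \<longrightarrow> vector_field (D X Y)) \<and>
     (\<forall>X X' Y. vector_field X \<longrightarrow> vector_field X' \<longrightarrow> vector_field Y \<longrightarrow>
        (\<forall>p\<in>U2. D (\<lambda>q. X q + X' q) Y p = D X Y p + D X' Y p)) \<and>
     (\<forall>f X Y. smooth_U2 f \<longrightarrow> vector_field X \<longrightarrow> vector_field Y \<longrightarrow>
        (\<forall>p\<in>U2. D (\<lambda>q. f q *\<^sub>R X q) Y p = f p *\<^sub>R D X Y p)) \<and>
     (\<forall>X Y Y'. vector_field X \<longrightarrow> vector_field Y \<longrightarrow> vector_field Y' \<longrightarrow>
        (\<forall>p\<in>U2. D X (\<lambda>q. Y q + Y' q) p = D X Y p + D X Y' p)) \<and>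
     (\<forall>f X Y. smooth_U2 f \<longrightarrow> vector_field X \<longrightarrow> vector_field Y \<longrightarrow>
        (\<forall>p\<in>U2. D X (\<lambda>q. f q *\<^sub>R Y q) p = ddir f p (X p) *\<^sub>R Y p + f p *\<^sub>R D X Y p))"

definition levi_civita :: "((mat2 \<Rightarrow> mat2) \<Rightarrow> (mat2 \<Rightarrow> mat2) \<Rightarrow> mat2 \<Rightarrow> mat2) \<Rightarrow> bool" where
  "levi_civita D \<longleftrightarrow> affine_connection D \<and>
     (\<forall>X Y. vector_field X \<longrightarrow> vector_field Y \<longrightarrow>
        (\<forall>p\<in>U2. D X Y p - D Y X p = bracket X Y p)) \<and>
     (\<forall>X Y Z. vector_field X \<longrightarrow> vector_field Y \<longrightarrow> vector_field Z \<longrightarrow>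
        (\<forall>p\<in>U2. ddir (\<lambda>q. lmetric q (Y q) (Z q)) p (X p)
           = lmetric p (D X Y p) (Z p) + lmetric p (Y p) (D X Z p)))"

definition curvature :: "((mat2 \<Rightarrow> mat2) \<Rightarrow> (mat2 \<Rightarrow> mat2) \<Rightarrow> mat2 \<Rightarrow> mat2)
    \<Rightarrow> (mat2 \<Rightarrow> mat2) \<Rightarrow> (mat2 \<Rightarrow> mat2) \<Rightarrow> (mat2 \<Rightarrow> mat2) \<Rightarrow> mat2 \<Rightarrow> mat2" where
  "curvature D X Y Z p = D X (D Y Z) p - D Y (D X Z) p - D (bracket X Y) Z p"

definition parallel_curvature :: "((mat2 \<Rightarrow> mat2) \<Rightarrow> (mat2 \<Rightarrow> mat2) \<Rightarrow> mat2 \<Rightarrow> mat2) \<Rightarrow> bool" where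
  "parallel_curvature D \<longleftrightarrow>
     (\<forall>W X Y Z. vector_field W \<longrightarrow> vector_field X \<longrightarrow> vector_field Y \<longrightarrow> vector_field Z \<longrightarrow>
        (\<forall>p\<in>U2. D W (curvature D X Y Z) p - curvature D (D W X) Y Z p
           - curvature D X (D W Y) Z p - curvature D X Y (D W Z) p = 0))"


section \<open>Parallel transport and holonomy\<close>

definition piecewise_smooth :: "(real \<Rightarrow> mat2) \<Rightarrow> bool" where
  "piecewise_smooth \<gamma> \<longleftrightarrow>
     (\<exists>(n::nat) s. s 0 = 0 \<and> s n = 1 \<and> (\<forall>i<n. s i < s (Suc i) \<and>
        (\<exists>S h. open S \<and> {s i..s (Suc i)} \<subseteq> S \<and> (\<forall>k. Ck_on k S h) \<and>
           (\<forall>t\<in>{s i..s (Suc i)}. \<gamma> t = h t))))"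

definition loop_at :: "mat2 \<Rightarrow> (real \<Rightarrow> mat2) \<Rightarrow> bool" where
  "loop_at p \<gamma> \<longleftrightarrow> piecewise_smooth \<gamma> \<and> (\<forall>t\<in>{0..1}. \<gamma> t \<in> U2) \<and> \<gamma> 0 = p \<and> \<gamma> 1 = p"

text \<open>Covariant derivative at \<open>t\<close> of a vector field \<open>V\<close> along \<open>\<gamma>\<close>: expand \<open>V\<close> in the global
  orthonormal frame and apply the Leibniz rule. As \<open>D X E p\<close> depends on \<open>X\<close> only through \<open>X p\<close>,
  the velocity may be extended to the left-invariant field through it.\<close>

definition cov_deriv :: "((mat2 \<Rightarrow> mat2) \<Rightarrow> (mat2 \<Rightarrow> mat2) \<Rightarrow> mat2 \<Rightarrow> mat2)
    \<Rightarrow> (real \<Rightarrow> mat2) \<Rightarrow> (real \<Rightarrow> mat2) \<Rightarrow> real \<Rightarrow> mat2" where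
  "cov_deriv D \<gamma> V t =
     (\<Sum>A\<in>frame.
        vector_derivative (\<lambda>s. lmetric (\<gamma> s) (linv A (\<gamma> s)) (V s)) (at t) *\<^sub>R linv A (\<gamma> t)
        + lmetric (\<gamma> t) (linv A (\<gamma> t)) (V t) *\<^sub>R
            D (linv (herm_adj (\<gamma> t) ** vector_derivative \<gamma> (at t))) (linv A) (\<gamma> t))"

text \<open>The finite exceptional set accommodates the break points of a piecewise smooth curve.\<close>

definition parallel_along :: "((mat2 \<Rightarrow> mat2) \<Rightarrow> (mat2 \<Rightarrow> mat2) \<Rightarrow> mat2 \<Rightarrow> mat2)
    \<Rightarrow> (real \<Rightarrow> mat2) \<Rightarrow> (real \<Rightarrow> mat2) \<Rightarrow> bool" where
  "parallel_along D \<gamma> V \<longleftrightarrow>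
     continuous_on {0..1} V \<and> (\<forall>t\<in>{0..1}. V t \<in> tangent (\<gamma> t)) \<and>
     (\<exists>K. finite K \<and> (\<forall>t\<in>{0..1} - K.
        \<gamma> differentiable (at t) \<and> V differentiable (at t) \<and> cov_deriv D \<gamma> V t = 0))"

text \<open>Only the restriction of \<open>h\<close> to \<open>tangent p\<close> is meaningful here.\<close>

definition holonomy_group :: "((mat2 \<Rightarrow> mat2) \<Rightarrow> (mat2 \<Rightarrow> mat2) \<Rightarrow> mat2 \<Rightarrow> mat2)
    \<Rightarrow> mat2 \<Rightarrow> (mat2 \<Rightarrow> mat2) set" where
  "holonomy_group D p = {h. \<exists>\<gamma>. loop_at p \<gamma> \<and>
     (\<forall>v\<in>tangent p. \<exists>V. parallel_along D \<gamma> V \<and> V 0 = v \<and> V 1 = h v)}"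

text \<open>Endomorphisms of \<open>tangent p\<close>, extended by zero so that each has one representative.\<close>

definition endo :: "mat2 \<Rightarrow> (mat2 \<Rightarrow> mat2) set" where
  "endo p = {A. (\<forall>v\<in>tangent p. A v \<in> tangent p) \<and>
     (\<forall>v\<in>tangent p. \<forall>w\<in>tangent p. A (v + w) = A v + A w) \<and>
     (\<forall>c::real. \<forall>v\<in>tangent p. A (c *\<^sub>R v) = c *\<^sub>R A v) \<and>
     (\<forall>v. v \<notin> tangent p \<longrightarrow> A v = 0)}"

definition endo_exp :: "(mat2 \<Rightarrow> mat2) \<Rightarrow> mat2 \<Rightarrow> mat2" where
  "endo_exp A v = (\<Sum>n. (A ^^ n) v /\<^sub>R fact n)"

definition holonomy_algebra :: "((mat2 \<Rightarrow> mat2) \<Rightarrow> (mat2 \<Rightarrow> mat2) \<Rightarrow> mat2 \<Rightarrow> mat2)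
    \<Rightarrow> mat2 \<Rightarrow> (mat2 \<Rightarrow> mat2) set" where
  "holonomy_algebra D p =
     {A \<in> endo p. \<forall>t::real. endo_exp (\<lambda>v. t *\<^sub>R A v) \<in> holonomy_group D p}"

text \<open>\<open>H\<close> is a real Lie algebra of endomorphisms (with the commutator bracket), isomorphic to
  the Lie algebra \<open>L\<close> of square matrices.\<close>

definition lie_isomorphic :: "(mat2 \<Rightarrow> mat2) set \<Rightarrow> ('k::real_normed_field^'n^'n) set \<Rightarrow> bool" where
  "lie_isomorphic H L \<longleftrightarrow>
     (\<forall>A\<in>H. \<forall>B\<in>H. (\<lambda>v. A v + B v) \<in> H \<and> (\<lambda>v. A (B v) - B (A v)) \<in> H) \<and>
     (\<forall>c::real. \<forall>A\<in>H. (\<lambda>v. c *\<^sub>R A v) \<in> H) \<and>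
     (\<exists>\<Phi>. bij_betw \<Phi> H L \<and>
        (\<forall>A\<in>H. \<forall>B\<in>H. \<Phi> (\<lambda>v. A v + B v) = \<Phi> A + \<Phi> B) \<and>
        (\<forall>c::real. \<forall>A\<in>H. \<Phi> (\<lambda>v. c *\<^sub>R A v) = c *\<^sub>R \<Phi> A) \<and>
        (\<forall>A\<in>H. \<forall>B\<in>H. \<Phi> (\<lambda>v. A (B v) - B (A v)) = \<Phi> A ** \<Phi> B - \<Phi> B ** \<Phi> A))"


section \<open>Consistency of the conventions\<close>

lemma mat2_eq_iff:
  "(A :: 'a^2^2) = B \<longleftrightarrow>
     A $ 1 $ 1 = B $ 1 $ 1 \<and> A $ 1 $ 2 = B $ 1 $ 2 \<and> A $ 2 $ 1 = B $ 2 $ 1 \<and> A $ 2 $ 2 = B $ 2 $ 2"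
  by (auto simp: vec_eq_iff forall_2)

lemma frame_entries [simp]:
  "X12 $ 1 $ 1 = 0" "X12 $ 1 $ 2 = 1" "X12 $ 2 $ 1 = - 1" "X12 $ 2 $ 2 = 0"
  "Y12 $ 1 $ 1 = 0" "Y12 $ 1 $ 2 = \<i>" "Y12 $ 2 $ 1 = \<i>" "Y12 $ 2 $ 2 = 0"
  "xi1 $ 1 $ 1 = \<i>" "xi1 $ 1 $ 2 = 0" "xi1 $ 2 $ 1 = 0" "xi1 $ 2 $ 2 = 0"
  "xi2 $ 1 $ 1 = 0" "xi2 $ 1 $ 2 = 0" "xi2 $ 2 $ 1 = 0" "xi2 $ 2 $ 2 = - \<i>"
  by (simp_all add: X12_def Y12_def xi1_def xi2_def elem_def cscale_def)

lemma frame_brackets: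
  "X12 ** Y12 - Y12 ** X12 = 2 *\<^sub>R (xi1 + xi2)"
  "X12 ** xi1 - xi1 ** X12 = - Y12" "X12 ** xi2 - xi2 ** X12 = - Y12"
  "Y12 ** xi1 - xi1 ** Y12 = X12" "Y12 ** xi2 - xi2 ** Y12 = X12"
  "xi1 ** xi2 - xi2 ** xi1 = 0"
  by (simp_all add: mat2_eq_iff matrix_matrix_mult_def sum_2 complex_eq_iff)

lemma frame_u_alg: "X12 \<in> u_alg" "Y12 \<in> u_alg" "xi1 \<in> u_alg" "xi2 \<in> u_alg"
  by (simp_all add: u_alg_def herm_adj_def mat2_eq_iff)

lemma u_alg_expansion:
  assumes "A \<in> u_alg"
  shows "A = ip_e X12 A *\<^sub>R X12 + ip_e Y12 A *\<^sub>R Y12 + ip_e xi1 A *\<^sub>R xi1 + ip_e xi2 A *\<^sub>R xi2"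
proof -
  have "cnj (A $ 1 $ 1) = - A $ 1 $ 1" "cnj (A $ 1 $ 2) = - A $ 2 $ 1" "cnj (A $ 2 $ 2) = - A $ 2 $ 2"
    using assms by (simp_all add: u_alg_def herm_adj_def mat2_eq_iff)
  then show ?thesis
    by (simp add: mat2_eq_iff ip_e_def complex_eq_iff)
qed

lemma U2_inverse:
  assumes "p \<in> U2"
  shows "herm_adj p ** p = mat 1" "p ** herm_adj p = mat 1"
  using assms matrix_left_right_inverse[of "herm_adj p" p] by (auto simp: U2_def)

lemma lmetric_linv: "p \<in> U2 \<Longrightarrow> lmetric p (linv A p) (linv B p) = ip_e A B"
  by (simp add: lmetric_def linv_def matrix_mul_assoc U2_inverse)

lemma frame_distinct: "distinct [X12, Y12, xi1, xi2]"
  by (simp add: mat2_eq_iff)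

lemma lmetric_orthonormal:
  assumes "p \<in> U2" "A \<in> frame" "B \<in> frame"
  shows "lmetric p (linv A p) (linv B p) = (if A = B then 1 else 0)"
proof -
  have "ip_e A B = (if A = B then 1 else 0)"
    using assms(2,3) frame_distinct unfolding frame_def by (auto simp: ip_e_def)
  then show ?thesis using assms(1) by (simp add: lmetric_linv)
qed

lemma phi_frame:
  assumes "p \<in> U2"
  shows "phi p (linv X12 p) = linv Y12 p" "phi p (linv Y12 p) = - linv X12 p"
    "phi p (linv xi1 p) = 0" "phi p (linv xi2 p) = 0"
  using assms by (simp_all add: phi_def lmetric_linv ip_e_def)

end

theory Submission
  imports Defs
begin

text \<open>
The vector fields \<open>X12, Y12, xi1, xi2\<close> trivialise the tangent bundle, so a vector field \<open>X\<close> becomes the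
u(2)-valued function \<open>x(q) = q\<^sup>* X(q)\<close>. The Koszul formula together with the torsion term gives, on
left-invariant fields, \<open>\<nabla>\<^sub>A B = \<theta>(A) \<phi> B\<close> with \<open>\<theta> = - (\<eta>\<^sub>1 + \<eta>\<^sub>2)\<close>: of the
Levi-Civita connection plus torsion only a multiple of the one skew endomorphism \<open>\<phi>\<close> survives (lemma \<open>nabla_linv\<close>). By the
Leibniz rule the whole connection is then \<open>\<nabla> = d + \<theta> \<otimes> \<phi>\<close> in the trivialisation (lemma \<open>ltriv_nabla\<close>),
a connection with abelian structure group.

Hence the curvature is \<open>d\<theta> \<otimes> \<phi>\<close>, and \<open>d\<theta>(A,B) = - \<theta>([A,B])\<close> (lemma \<open>ltriv_curvature\<close>); the only
analytic ingredient here is that second derivatives commute, which yields \<open>X(Y f) - Y(X f) = [X,Y] f\<close>.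
Both \<open>\<phi>\<close> and \<open>d\<theta>\<close>, a multiple of the fundamental 2-form on the plane of \<open>X12\<close> and \<open>Y12\<close>, are invariant
under the rotations \<open>exp(a \<phi>)\<close>, so the curvature is parallel (lemma \<open>parallel_curvature\<close>).

For the holonomy algebra, a parallel field along a curve satisfies \<open>v' = - \<theta>(\<gamma>\<^sup>* \<gamma>') \<phi> v\<close> in the
trivialisation, so transport preserves the metric and the components along \<open>xi1\<close> and \<open>xi2\<close> (lemma
\<open>parallel_transport_invariants\<close>). Differentiating a one-parameter group of such maps at the identity gives
a skew endomorphism whose image is orthogonal to \<open>xi1\<close> and \<open>xi2\<close>, that is a multiple of \<open>\<phi>\<close>. Conversely every rotation
\<open>exp(a \<phi>)\<close> is the holonomy of an explicit loop: for \<open>N \<in> su(2)\<close> with \<open>N\<^sup>2 = - 1\<close>, the closed one-parameter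
group \<open>p exp(2 \<pi> s N)\<close> has constant velocity \<open>2 \<pi> N\<close>, hence holonomy \<open>exp(- 2 \<pi> \<theta>(N) \<phi>)\<close>, and by choosing the axis
of \<open>N\<close> the number \<open>- 2 \<pi> \<theta>(N)\<close> takes every value between \<open>- 4 \<pi>\<close> and \<open>4 \<pi>\<close> (lemma
\<open>rotation_in_holonomy_group\<close>). So the holonomy algebra is the line spanned by \<open>\<phi>\<close>, as are so(2) and u(1)
lines of commuting matrices.
\<close>

section \<open>Calculus of smooth maps\<close>

text \<open>Frechet derivatives at a point of an open set depend only on values in that set, so the predicate
does, although its recursive clause mentions the derivative of the total function.\<close>

lemma Ck_on_cong:
  assumes "open S" "\<And>x. x \<in> S \<Longrightarrow> f x = g x"
  shows "Ck_on k S f \<longleftrightarrow> Ck_on k S g"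
proof -
  have "Ck_on k S g" if "Ck_on k S f" "\<And>x. x \<in> S \<Longrightarrow> f x = g x" for f g :: "'a \<Rightarrow> 'b"
    using that
  proof (induction k arbitrary: f g)
    case 0
    then show ?case by (simp cong: continuous_on_cong)
  next
    case (Suc k)
    have d: "g differentiable (at x)" if "x \<in> S" for x
    proof -
      from Suc.prems(1) that obtain f' where "(f has_derivative f') (at x)"
        by (auto simp: differentiable_def)
      then have "(g has_derivative f') (at x)"
        using has_derivative_transform_within_open[OF _ assms(1) that] Suc.prems(2) by blast
      then show ?thesis by (auto simp: differentiable_def)
    qed
    have "frechet_derivative f (at x) = frechet_derivative g (at x)" if "x \<in> S" for x
      using Suc.prems that by (intro frechet_derivative_transform_within_open[OF _ assms(1)]) auto
    then have "Ck_on k S (\<lambda>x. frechet_derivative g (at x) v)" for v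
      using Suc.IH[of "\<lambda>x. frechet_derivative f (at x) v"] Suc.prems(1) by simp
    with d show ?case by simp
  qed
  then show ?thesis using assms(2) by metis
qed

text \<open>Lets the derivative be given in closed form, which is how every closure property below is proved by
induction on the order of differentiability.\<close>

lemma Ck_on_Suc_intro:
  assumes S: "open S" and "\<And>x. x \<in> S \<Longrightarrow> (f has_derivative f' x) (at x)"
    and "\<And>v. Ck_on k S (\<lambda>x. f' x v)"
  shows "Ck_on (Suc k) S f"
proof -
  have "frechet_derivative f (at x) = f' x" if "x \<in> S" for x
    using assms(2)[OF that] by (metis frechet_derivative_at)
  then have "Ck_on k S (\<lambda>x. frechet_derivative f (at x) v)" for v
    using assms(3)[of v] Ck_on_cong[OF S, of "\<lambda>x. frechet_derivative f (at x) v" "\<lambda>x. f' x v" k]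
    by simp
  then show ?thesis using assms(2) by (auto simp: differentiable_def)
qed

lemma Ck_on_Suc_has_derivative:
  assumes "Ck_on (Suc k) S f" "x \<in> S"
  shows "(f has_derivative frechet_derivative f (at x)) (at x)"
  using assms by (simp add: frechet_derivative_works)

lemma Ck_on_SucD: "Ck_on (Suc k) S f \<Longrightarrow> Ck_on k S f"
proof (induction k arbitrary: f)
  case 0
  then have "f differentiable (at x)" if "x \<in> S" for x using that by simp
  then show ?case
    by (auto intro!: continuous_at_imp_continuous_on differentiable_imp_continuous_within)
next
  case (Suc k)
  have "Ck_on k S (\<lambda>x. frechet_derivative f (at x) v)" for v
    using Suc.prems by (intro Suc.IH) (metis Ck_on.simps(2))
  moreover have "\<forall>x\<in>S. f differentiable (at x)" using Suc.prems by (metis Ck_on.simps(2))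
  ultimately show ?case unfolding Ck_on.simps(2)[of k] by blast
qed

lemma Ck_on_mono: "Ck_on k S f \<Longrightarrow> T \<subseteq> S \<Longrightarrow> Ck_on k T f"
proof (induction k arbitrary: f)
  case (Suc k)
  then show ?case unfolding Ck_on.simps(2) by blast
qed (auto intro: continuous_on_subset)

lemma Ck_on_const: "open S \<Longrightarrow> Ck_on k S (\<lambda>x. c)"
proof (induction k arbitrary: c)
  case (Suc k)
  show ?case by (rule Ck_on_Suc_intro[OF Suc.prems, where f'="\<lambda>x v. 0"]) (simp_all add: Suc)
qed simp

lemma Ck_on_add:
  assumes "open S"
  shows "Ck_on k S f \<Longrightarrow> Ck_on k S g \<Longrightarrow> Ck_on k S (\<lambda>x. f x + g x)"
proof (induction k arbitrary: f g)
  case 0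
  then show ?case by (auto intro: continuous_intros)
next
  case (Suc k)
  show ?case
  proof (rule Ck_on_Suc_intro[OF assms])
    show "((\<lambda>x. f x + g x) has_derivative
        (\<lambda>v. frechet_derivative f (at x) v + frechet_derivative g (at x) v)) (at x)" if "x \<in> S" for x
      using Suc.prems that by (intro has_derivative_add Ck_on_Suc_has_derivative)
    show "Ck_on k S (\<lambda>x. frechet_derivative f (at x) v + frechet_derivative g (at x) v)" for v
      using Suc.prems by (intro Suc.IH) auto
  qed
qed

lemma Ck_on_bounded_linear:
  assumes "open S" "bounded_linear L"
  shows "Ck_on k S f \<Longrightarrow> Ck_on k S (\<lambda>x. L (f x))"
proof (induction k arbitrary: f)
  case 0
  then show ?case using assms(2) by (auto intro: bounded_linear.continuous_on)
next
  case (Suc k)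
  show ?case
  proof (rule Ck_on_Suc_intro[OF assms(1)])
    show "((\<lambda>x. L (f x)) has_derivative (\<lambda>v. L (frechet_derivative f (at x) v))) (at x)"
      if "x \<in> S" for x
      using Suc.prems that by (intro bounded_linear.has_derivative[OF assms(2)] Ck_on_Suc_has_derivative)
    show "Ck_on k S (\<lambda>x. L (frechet_derivative f (at x) v))" for v
      using Suc.prems by (intro Suc.IH) auto
  qed
qed

lemma Ck_on_bounded_bilinear:
  assumes "open S" "bounded_bilinear B"
  shows "Ck_on k S f \<Longrightarrow> Ck_on k S g \<Longrightarrow> Ck_on k S (\<lambda>x. B (f x) (g x))"
proof (induction k arbitrary: f g)
  case 0
  then show ?case using assms(2) by (auto intro: bounded_bilinear.continuous_on)
next
  case (Suc k)
  show ?case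
  proof (rule Ck_on_Suc_intro[OF assms(1)])
    show "((\<lambda>x. B (f x) (g x)) has_derivative
        (\<lambda>v. B (f x) (frechet_derivative g (at x) v) + B (frechet_derivative f (at x) v) (g x))) (at x)"
      if "x \<in> S" for x
      using Suc.prems that by (intro bounded_bilinear.FDERIV[OF assms(2)] Ck_on_Suc_has_derivative)
    show "Ck_on k S (\<lambda>x. B (f x) (frechet_derivative g (at x) v)
        + B (frechet_derivative f (at x) v) (g x))" for v
      using Suc.prems Ck_on_SucD[OF Suc.prems(1)] Ck_on_SucD[OF Suc.prems(2)]
      by (intro Ck_on_add[OF assms(1)] Suc.IH) auto
  qed
qed

lemma Ck_on_ident: "open S \<Longrightarrow> Ck_on k S (\<lambda>x. x)"
proof (cases k)
  case (Suc l)
  assume "open S"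
  then show ?thesis unfolding Suc
    by (intro Ck_on_Suc_intro[where f'="\<lambda>x v. v"]) (simp_all add: Ck_on_const)
qed simp

text \<open>The mean value theorem is applied twice: in direction \<open>u\<close> to \<open>x \<mapsto> f (x + s v) - f x\<close>, then in
direction \<open>v\<close> to the resulting difference of values of \<open>fu\<close>.\<close>

lemma second_difference_mean_value:
  fixes f fu fuv :: "'a::real_normed_vector \<Rightarrow> real"
  assumes s: "s > 0"
    and S: "\<And>a b. 0 \<le> a \<Longrightarrow> a \<le> s \<Longrightarrow> 0 \<le> b \<Longrightarrow> b \<le> s \<Longrightarrow> p + a *\<^sub>R u + b *\<^sub>R v \<in> S"
    and fu: "\<And>x. x \<in> S \<Longrightarrow> ((\<lambda>t. f (x + t *\<^sub>R u)) has_real_derivative fu x) (at 0)"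
    and fuv: "\<And>x. x \<in> S \<Longrightarrow> ((\<lambda>t. fu (x + t *\<^sub>R v)) has_real_derivative fuv x) (at 0)"
  obtains a b where "0 < a" "a < s" "0 < b" "b < s"
    "f (p + s *\<^sub>R u + s *\<^sub>R v) - f (p + s *\<^sub>R u) - f (p + s *\<^sub>R v) + f p
      = s\<^sup>2 * fuv (p + a *\<^sub>R u + b *\<^sub>R v)"
proof -
  have shift: "((\<lambda>t. g (y + t *\<^sub>R w)) has_real_derivative gw (y + a *\<^sub>R w)) (at a)"
    if "((\<lambda>t. g (y + a *\<^sub>R w + t *\<^sub>R w)) has_real_derivative gw (y + a *\<^sub>R w)) (at 0)"
    for g gw :: "'a \<Rightarrow> real" and y w a
    using that DERIV_shift[of "\<lambda>t. g (y + t *\<^sub>R w)" "gw (y + a *\<^sub>R w)" 0 a]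
    by (simp add: algebra_simps)
  have "\<exists>a>0. a < s \<and> (f (p + s *\<^sub>R v + s *\<^sub>R u) - f (p + s *\<^sub>R u))
      - (f (p + s *\<^sub>R v + 0 *\<^sub>R u) - f (p + 0 *\<^sub>R u))
      = (s - 0) * (fu (p + s *\<^sub>R v + a *\<^sub>R u) - fu (p + a *\<^sub>R u))"
  proof (rule MVT2[OF s])
    fix a assume a: "0 \<le> a" "a \<le> s"
    have "p + s *\<^sub>R v + a *\<^sub>R u \<in> S" "p + a *\<^sub>R u \<in> S"
      using S[OF a, of s] S[OF a, of 0] s by (simp_all add: algebra_simps)
    then show "((\<lambda>t. f (p + s *\<^sub>R v + t *\<^sub>R u) - f (p + t *\<^sub>R u)) has_real_derivative
        fu (p + s *\<^sub>R v + a *\<^sub>R u) - fu (p + a *\<^sub>R u)) (at a)"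
      by (intro DERIV_diff shift[where gw=fu] fu)
  qed
  then obtain a where a: "0 < a" "a < s" and
    1: "f (p + s *\<^sub>R v + s *\<^sub>R u) - f (p + s *\<^sub>R u) - (f (p + s *\<^sub>R v) - f p)
      = s * (fu (p + s *\<^sub>R v + a *\<^sub>R u) - fu (p + a *\<^sub>R u))"
    by auto
  have "\<exists>b>0. b < s \<and> fu (p + a *\<^sub>R u + s *\<^sub>R v) - fu (p + a *\<^sub>R u + 0 *\<^sub>R v)
      = (s - 0) * fuv (p + a *\<^sub>R u + b *\<^sub>R v)"
  proof (rule MVT2[OF s])
    fix b assume b: "0 \<le> b" "b \<le> s"
    show "((\<lambda>t. fu (p + a *\<^sub>R u + t *\<^sub>R v)) has_real_derivative fuv (p + a *\<^sub>R u + b *\<^sub>R v)) (at b)"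
      using a b by (intro shift[where gw=fuv] fuv S) auto
  qed
  then obtain b where b: "0 < b" "b < s" and
    2: "fu (p + a *\<^sub>R u + s *\<^sub>R v) - fu (p + a *\<^sub>R u) = s * fuv (p + a *\<^sub>R u + b *\<^sub>R v)"
    by auto
  have "f (p + s *\<^sub>R u + s *\<^sub>R v) - f (p + s *\<^sub>R u) - f (p + s *\<^sub>R v) + f p
      = s\<^sup>2 * fuv (p + a *\<^sub>R u + b *\<^sub>R v)"
    using 1 2 by (simp add: algebra_simps power2_eq_square)
  with a b that show thesis by blast
qed

text \<open>Schwarz's theorem. The second difference is symmetric in \<open>u\<close> and \<open>v\<close>, so evaluating it in
both orders equates a value of \<open>fuv\<close> and a value of \<open>fvu\<close> at points that tend to \<open>p\<close>.\<close>

lemma mixed_directional_derivatives_commute: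
  fixes f fu fv fuv fvu :: "'a::real_normed_vector \<Rightarrow> real"
  assumes S: "open S" "p \<in> S"
    and fu: "\<And>x. x \<in> S \<Longrightarrow> ((\<lambda>t. f (x + t *\<^sub>R u)) has_real_derivative fu x) (at 0)"
    and fv: "\<And>x. x \<in> S \<Longrightarrow> ((\<lambda>t. f (x + t *\<^sub>R v)) has_real_derivative fv x) (at 0)"
    and fuv: "\<And>x. x \<in> S \<Longrightarrow> ((\<lambda>t. fu (x + t *\<^sub>R v)) has_real_derivative fuv x) (at 0)"
    and fvu: "\<And>x. x \<in> S \<Longrightarrow> ((\<lambda>t. fv (x + t *\<^sub>R u)) has_real_derivative fvu x) (at 0)"
    and cont: "continuous_on S fuv" "continuous_on S fvu"
  shows "fuv p = fvu p"
proof -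
  have "\<bar>fuv p - fvu p\<bar> \<le> e" if e: "e > 0" for e
  proof -
    have "\<forall>\<^sub>F x in nhds p. x \<in> S" using S by (metis eventually_nhds)
    moreover have "\<forall>\<^sub>F x in nhds p. dist (fuv x) (fuv p) < e / 2"
      using cont(1) S e by (intro tendstoD) (auto simp: continuous_on_eq_continuous_at isCont_def tendsto_nhds_iff)
    moreover have "\<forall>\<^sub>F x in nhds p. dist (fvu x) (fvu p) < e / 2"
      using cont(2) S e by (intro tendstoD) (auto simp: continuous_on_eq_continuous_at isCont_def tendsto_nhds_iff)
    ultimately have "\<forall>\<^sub>F x in nhds p. x \<in> S \<and> dist (fuv x) (fuv p) < e / 2 \<and> dist (fvu x) (fvu p) < e / 2"
      by eventually_elim auto
    then obtain r where r: "r > 0" and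
      near: "\<And>x. dist x p < r \<Longrightarrow> x \<in> S \<and> dist (fuv x) (fuv p) < e / 2 \<and> dist (fvu x) (fvu p) < e / 2"
      unfolding eventually_nhds_metric by auto
    \<comment> \<open>The parallelogram with sides \<open>s u\<close> and \<open>s v\<close> then stays within distance \<open>r\<close> of \<open>p\<close>; the summand 1 avoids division by zero.\<close>
    define s where "s = r / (norm u + norm v + 1)"
    have pos: "norm u + norm v + 1 > 0" by (simp add: add_nonneg_pos)
    have s: "s > 0" using r pos by (simp add: s_def)
    have box: "dist (p + a *\<^sub>R u + b *\<^sub>R v) p < r" if "0 \<le> a" "a \<le> s" "0 \<le> b" "b \<le> s" for a b
    proof -
      have "dist (p + a *\<^sub>R u + b *\<^sub>R v) p \<le> a * norm u + b * norm v"
        using norm_triangle_ineq[of "a *\<^sub>R u" "b *\<^sub>R v"] that by (simp add: dist_norm add.assoc)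
      also have "\<dots> \<le> s * norm u + s * norm v"
        using that by (intro add_mono mult_right_mono) auto
      also have "\<dots> < s * (norm u + norm v + 1)" using s by (simp add: algebra_simps)
      also have "\<dots> = r" using pos by (simp add: s_def)
      finally show ?thesis .
    qed
    obtain a b where ab: "0 < a" "a < s" "0 < b" "b < s" and
      1: "f (p + s *\<^sub>R u + s *\<^sub>R v) - f (p + s *\<^sub>R u) - f (p + s *\<^sub>R v) + f p
        = s\<^sup>2 * fuv (p + a *\<^sub>R u + b *\<^sub>R v)"
    proof (rule second_difference_mean_value[OF s _ fu fuv, where p=p])
      show "p + a *\<^sub>R u + b *\<^sub>R v \<in> S" if "0 \<le> a" "a \<le> s" "0 \<le> b" "b \<le> s" for a b
        using box[of a b] near that by simp
    qed auto
    obtain c d where cd: "0 < c" "c < s" "0 < d" "d < s" and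
      2: "f (p + s *\<^sub>R v + s *\<^sub>R u) - f (p + s *\<^sub>R v) - f (p + s *\<^sub>R u) + f p
        = s\<^sup>2 * fvu (p + c *\<^sub>R v + d *\<^sub>R u)"
    proof (rule second_difference_mean_value[OF s _ fv fvu, where p=p])
      show "p + a *\<^sub>R v + b *\<^sub>R u \<in> S" if "0 \<le> a" "a \<le> s" "0 \<le> b" "b \<le> s" for a b
        using box[of b a] near that by (simp add: algebra_simps)
    qed auto
    have "s\<^sup>2 * fuv (p + a *\<^sub>R u + b *\<^sub>R v) = s\<^sup>2 * fvu (p + c *\<^sub>R v + d *\<^sub>R u)"
      using 1 2 by (simp add: algebra_simps)
    then have eq: "fuv (p + a *\<^sub>R u + b *\<^sub>R v) = fvu (p + d *\<^sub>R u + c *\<^sub>R v)"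
      using s by (simp add: algebra_simps)
    have "dist (fuv (p + a *\<^sub>R u + b *\<^sub>R v)) (fuv p) < e / 2"
      "dist (fvu (p + d *\<^sub>R u + c *\<^sub>R v)) (fvu p) < e / 2"
      using near box ab cd by (simp_all add: less_imp_le)
    with eq show ?thesis unfolding dist_real_def by linarith
  qed
  then have "\<bar>fuv p - fvu p\<bar> \<le> 0" by (rule field_le_epsilon) simp
  then show ?thesis by simp
qed

lemma has_derivative_along_line:
  assumes "(f has_derivative f') (at x)"
  shows "((\<lambda>t. f (x + t *\<^sub>R u)) has_vector_derivative f' u) (at 0)"
proof -
  have "((\<lambda>t. x + t *\<^sub>R u) has_derivative (\<lambda>t. t *\<^sub>R u)) (at 0)"
    by (auto intro!: derivative_eq_intros)
  moreover have "(f has_derivative f') (at (x + 0 *\<^sub>R u))" using assms by simp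
  ultimately have "((\<lambda>t. f (x + t *\<^sub>R u)) has_derivative (\<lambda>t. f' (t *\<^sub>R u))) (at 0)"
    using has_derivative_compose[of "\<lambda>t. x + t *\<^sub>R u" _ 0 UNIV f f'] by simp
  then show ?thesis
    using linear_scale[OF has_derivative_linear[OF assms]] by (simp add: has_vector_derivative_def)
qed

lemma second_frechet_derivative_symmetric:
  fixes h :: "'a::real_normed_vector \<Rightarrow> 'b::euclidean_space"
  assumes S: "open S" "p \<in> S" and C2: "Ck_on (Suc (Suc 0)) S h"
  shows "frechet_derivative (\<lambda>x. frechet_derivative h (at x) u) (at p) v
       = frechet_derivative (\<lambda>x. frechet_derivative h (at x) v) (at p) u"
proof (rule euclidean_eqI)
  fix b :: 'b assume "b \<in> Basis"
  let ?D = "\<lambda>u x. frechet_derivative h (at x) u"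
  let ?D2 = "\<lambda>u v x. frechet_derivative (?D u) (at x) v"
  have D: "((\<lambda>t. h (x + t *\<^sub>R u) \<bullet> b) has_real_derivative ?D u x \<bullet> b) (at 0)" if "x \<in> S" for x u
    using bounded_linear.has_vector_derivative[OF bounded_linear_inner_left[of b]
        has_derivative_along_line[OF Ck_on_Suc_has_derivative[OF C2 that], of u]]
    by (simp add: has_real_derivative_iff_has_vector_derivative)
  have C1: "Ck_on (Suc 0) S (?D u)" for u using C2 by simp
  have D2: "((\<lambda>t. ?D u (x + t *\<^sub>R v) \<bullet> b) has_real_derivative ?D2 u v x \<bullet> b) (at 0)"
    if "x \<in> S" for x u v
    using bounded_linear.has_vector_derivative[OF bounded_linear_inner_left[of b]
        has_derivative_along_line[OF Ck_on_Suc_has_derivative[OF C1[of u] that], of v]]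
    by (simp add: has_real_derivative_iff_has_vector_derivative)
  have "continuous_on S (?D2 u v)" for u v using C1[of u] by simp
  then show "?D2 u v p \<bullet> b = ?D2 v u p \<bullet> b"
    using mixed_directional_derivatives_commute[OF S D D D2 D2] by (simp add: continuous_on_inner)
qed

section \<open>Matrix algebra\<close>

lemma bounded_bilinear_matrix_mult:
  "bounded_bilinear ((**) :: complex^'n^'m \<Rightarrow> complex^'k^'n \<Rightarrow> complex^'k^'m)"
  unfolding bilinear_conv_bounded_bilinear[symmetric] bilinear_def
  by (auto intro!: linearI
      simp: vec_eq_iff matrix_matrix_mult_def scaleR_sum_right sum.distrib algebra_simps)

lemmas matrix_mult_add_left = bounded_bilinear.add_left[OF bounded_bilinear_matrix_mult]
lemmas matrix_mult_add_right = bounded_bilinear.add_right[OF bounded_bilinear_matrix_mult]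
lemmas matrix_mult_scaleR_left = bounded_bilinear.scaleR_left[OF bounded_bilinear_matrix_mult]
lemmas matrix_mult_scaleR_right = bounded_bilinear.scaleR_right[OF bounded_bilinear_matrix_mult]
lemmas matrix_mult_minus_left = bounded_bilinear.minus_left[OF bounded_bilinear_matrix_mult]
lemmas matrix_mult_minus_right = bounded_bilinear.minus_right[OF bounded_bilinear_matrix_mult]
lemmas matrix_mult_diff_left = bounded_bilinear.diff_left[OF bounded_bilinear_matrix_mult]
lemmas matrix_mult_diff_right = bounded_bilinear.diff_right[OF bounded_bilinear_matrix_mult]
lemmas matrix_mult_zero_left = bounded_bilinear.zero_left[OF bounded_bilinear_matrix_mult]
lemmas matrix_mult_zero_right = bounded_bilinear.zero_right[OF bounded_bilinear_matrix_mult]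

lemmas matrix_mult_linear_simps =
  matrix_mult_add_left matrix_mult_add_right matrix_mult_scaleR_left matrix_mult_scaleR_right
  matrix_mult_minus_left matrix_mult_minus_right matrix_mult_diff_left matrix_mult_diff_right
  matrix_mult_zero_left matrix_mult_zero_right

lemma bounded_linear_herm_adj: "bounded_linear (herm_adj :: complex^'n^'m \<Rightarrow> complex^'m^'n)"
  unfolding linear_conv_bounded_linear[symmetric]
  by (auto intro!: linearI simp: herm_adj_def vec_eq_iff)

lemma herm_adj_linear_simps:
  "herm_adj (A + B) = herm_adj A + herm_adj B" "herm_adj (A - B) = herm_adj A - herm_adj B"
  "herm_adj (- A) = - herm_adj A" "herm_adj (c *\<^sub>R A) = c *\<^sub>R herm_adj A" "herm_adj 0 = 0"
  by (simp_all add: herm_adj_def vec_eq_iff)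

lemma herm_adj_mult: "herm_adj (A ** B) = herm_adj B ** herm_adj A"
  by (simp add: herm_adj_def vec_eq_iff matrix_matrix_mult_def mult.commute)

lemma herm_adj_herm_adj [simp]: "herm_adj (herm_adj A) = A"
  by (simp add: herm_adj_def vec_eq_iff)

lemma herm_adj_mat_1 [simp]: "herm_adj (mat 1) = mat 1"
  by (simp add: herm_adj_def vec_eq_iff mat_def)

lemma u_alg_closed:
  "0 \<in> u_alg" "A \<in> u_alg \<Longrightarrow> B \<in> u_alg \<Longrightarrow> A + B \<in> u_alg" "A \<in> u_alg \<Longrightarrow> B \<in> u_alg \<Longrightarrow> A - B \<in> u_alg"
  "A \<in> u_alg \<Longrightarrow> c *\<^sub>R A \<in> u_alg" "A \<in> u_alg \<Longrightarrow> B \<in> u_alg \<Longrightarrow> A ** B - B ** A \<in> u_alg"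
  by (simp_all add: u_alg_def herm_adj_linear_simps herm_adj_mult matrix_mult_linear_simps)

lemma U2_cancel:
  assumes "p \<in> U2"
  shows "herm_adj p ** (p ** A) = A" "p ** (herm_adj p ** A) = A"
  using assms by (simp_all add: matrix_mul_assoc U2_inverse)

lemma tangent_linv: "A \<in> u_alg \<Longrightarrow> p ** A \<in> tangent p"
  by (auto simp: tangent_def)

lemma tangent_iff:
  assumes "p \<in> U2"
  shows "v \<in> tangent p \<longleftrightarrow> herm_adj p ** v \<in> u_alg"
proof
  show "herm_adj p ** v \<in> u_alg" if "v \<in> tangent p"
    using that by (auto simp: tangent_def U2_cancel[OF assms])
  show "v \<in> tangent p" if "herm_adj p ** v \<in> u_alg"
    using tangent_linv[OF that, of p] by (simp add: U2_cancel[OF assms])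
qed

lemma tangentE:
  assumes "v \<in> tangent p"
  obtains A where "A \<in> u_alg" "v = p ** A"
  using assms by (auto simp: tangent_def)

lemma tangent_closed:
  "v \<in> tangent p \<Longrightarrow> w \<in> tangent p \<Longrightarrow> v + w \<in> tangent p"
  "v \<in> tangent p \<Longrightarrow> w \<in> tangent p \<Longrightarrow> v - w \<in> tangent p"
  "v \<in> tangent p \<Longrightarrow> c *\<^sub>R v \<in> tangent p"
proof -
  show "v + w \<in> tangent p" "v - w \<in> tangent p" if "v \<in> tangent p" "w \<in> tangent p"
  proof -
    obtain A B where "A \<in> u_alg" "v = p ** A" "B \<in> u_alg" "w = p ** B"
      using \<open>v \<in> tangent p\<close> \<open>w \<in> tangent p\<close> by (metis tangentE)
    then show "v + w \<in> tangent p" "v - w \<in> tangent p"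
      using tangent_linv[of "A + B" p] tangent_linv[of "A - B" p]
      by (simp_all add: u_alg_closed matrix_mult_linear_simps)
  qed
  show "c *\<^sub>R v \<in> tangent p" if "v \<in> tangent p"
    using tangentE[OF that] tangent_linv[OF u_alg_closed(4)] by (metis matrix_mult_scaleR_right)
qed

text \<open>If \<open>E\<^sup>3 = - E\<close>, the exponential series of \<open>t E\<close> collapses to \<open>1 + sin t E + (1 - cos t) E\<^sup>2\<close>, so
the matrix below is \<open>p exp(t E)\<close>. The four frame vectors and the generators of the loops below are of this kind.\<close>

lemma unitary_one_parameter_group:
  assumes E: "E \<in> u_alg" and cube: "E ** (E ** E) = - E" and p: "p \<in> U2"
  shows "p ** (mat 1 + sin t *\<^sub>R E + (1 - cos t) *\<^sub>R (E ** E)) \<in> U2"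
proof -
  define Q d s where "Q = E ** E" "d = 1 - cos t" "s = sin t"
  have QE: "E ** Q = - E" "Q ** E = - E" "E ** E = Q" "Q ** Q = - Q"
    using cube by (simp_all add: Q_d_s_def matrix_mul_assoc[symmetric] matrix_mult_linear_simps)
  have adj: "herm_adj E = - E" "herm_adj Q = Q"
    using E by (simp_all add: u_alg_def Q_d_s_def herm_adj_mult matrix_mult_linear_simps)
  have "(mat 1 - s *\<^sub>R E + d *\<^sub>R Q) ** (mat 1 + s *\<^sub>R E + d *\<^sub>R Q)
      = mat 1 + (d *\<^sub>R Q + (d - s * s - d * d) *\<^sub>R Q)"
    by (simp add: matrix_mult_linear_simps QE scaleR_diff_left scaleR_diff_right scaleR_add_right)
  moreover have "d *\<^sub>R Q + (d - s * s - d * d) *\<^sub>R Q = 0"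
    using sin_cos_squared_add[of t]
    by (simp add: Q_d_s_def power2_eq_square algebra_simps flip: scaleR_add_left)
  ultimately have "(mat 1 - s *\<^sub>R E + d *\<^sub>R Q) ** (mat 1 + s *\<^sub>R E + d *\<^sub>R Q) = mat 1" by simp
  then have "herm_adj (p ** (mat 1 + s *\<^sub>R E + d *\<^sub>R Q)) ** (p ** (mat 1 + s *\<^sub>R E + d *\<^sub>R Q)) = mat 1"
    by (simp add: herm_adj_mult herm_adj_linear_simps adj matrix_mul_assoc[symmetric] U2_cancel[OF p])
  then show ?thesis by (simp add: U2_def Q_d_s_def)
qed

lemma frame_cube: "E \<in> frame \<Longrightarrow> E ** (E ** E) = - E"
  by (auto simp: frame_def mat2_eq_iff matrix_matrix_mult_def sum_2)

section \<open>Differentiation on U(2)\<close>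

text \<open>The last conclusion is what relates derivatives within U(2) to ordinary derivatives of a local
extension.\<close>

lemma smooth_U2_extension:
  assumes "smooth_U2 f" "p \<in> U2"
  obtains S h where "open S" "p \<in> S" "\<And>k. Ck_on k S h" "\<And>q. q \<in> S \<Longrightarrow> q \<in> U2 \<Longrightarrow> f q = h q"
    "\<And>q. q \<in> S \<Longrightarrow> q \<in> U2 \<Longrightarrow> (f has_derivative frechet_derivative h (at q)) (at q within U2)"
proof -
  obtain S h where S: "open S" "p \<in> S" and h: "\<And>k. Ck_on k S h"
    and eq: "\<And>q. q \<in> S \<Longrightarrow> q \<in> U2 \<Longrightarrow> f q = h q"
    using assms unfolding smooth_U2_def by (metis IntI)
  have "(f has_derivative frechet_derivative h (at q)) (at q within U2)" if q: "q \<in> S" "q \<in> U2" for q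
  proof -
    obtain d where d: "d > 0" "ball q d \<subseteq> S" using S(1) q(1) by (metis openE)
    have "(h has_derivative frechet_derivative h (at q)) (at q within U2)"
      using Ck_on_Suc_has_derivative[OF h[of "Suc 0"] q(1)] by (rule has_derivative_at_withinI)
    then show ?thesis
    proof (rule has_derivative_transform_within[OF _ d(1) q(2)])
      show "h x = f x" if "x \<in> U2" "dist x q < d" for x
        using that d eq[of x] by (auto simp: subset_iff dist_commute)
    qed
  qed
  with S h eq that show thesis by blast
qed

text \<open>The derivative within U(2) is chosen by Hilbert's operator and is not unique as a linear map on all matrices.
It is determined on tangent vectors because these are combinations of velocities at \<open>p\<close> of curves that
stay in U(2), one for each frame vector.\<close>

lemma ddir_eqI:
  assumes f': "(f has_derivative f') (at p within U2)" and p: "p \<in> U2" and v: "v \<in> tangent p"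
  shows "ddir f p v = f' v"
proof -
  let ?g = "frechet_derivative f (at p within U2)"
  have g: "(f has_derivative ?g) (at p within U2)"
    using f' by (metis frechet_derivative_works differentiable_def)
  have along: "((\<lambda>t. f (p ** (mat 1 + sin t *\<^sub>R E + (1 - cos t) *\<^sub>R (E ** E)))) has_vector_derivative
      F (p ** E)) (at 0)" (is "((\<lambda>t. f (?c t)) has_vector_derivative _) _")
    if F: "(f has_derivative F) (at p within U2)" and E: "E \<in> frame" for F E
  proof -
    have EU: "E \<in> u_alg" using E frame_u_alg by (auto simp: frame_def)
    have "((\<lambda>t. mat 1 + sin t *\<^sub>R E + (1 - cos t) *\<^sub>R (E ** E)) has_derivative (\<lambda>t. t *\<^sub>R E)) (at 0)"
      by (auto intro!: derivative_eq_intros)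
    from bounded_bilinear.FDERIV[OF bounded_bilinear_matrix_mult has_derivative_const this, of p]
    have c: "(?c has_derivative (\<lambda>t. t *\<^sub>R (p ** E))) (at 0 within UNIV)"
      by (simp add: matrix_mult_linear_simps)
    have "?c ` UNIV \<subseteq> U2" using unitary_one_parameter_group[OF EU frame_cube[OF E] p] by auto
    moreover have "?c 0 = p" by simp
    ultimately have "(f has_derivative F) (at (?c 0) within ?c ` UNIV)"
      using has_derivative_subset[OF F, of "range ?c"] by simp
    from has_derivative_in_compose[OF c this]
    show ?thesis
      using linear_scale[OF has_derivative_linear[OF F]] by (simp add: has_vector_derivative_def)
  qed
  have eq: "?g (p ** E) = f' (p ** E)" if "E \<in> frame" for E
    using along[OF g that] along[OF f' that] by (rule vector_derivative_unique_at)
  obtain A where A: "A \<in> u_alg" "v = p ** A" using v by (rule tangentE)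
  have lin: "linear ?g" "linear f'" using g f' by (simp_all add: has_derivative_linear)
  have "v = ip_e X12 A *\<^sub>R (p ** X12) + ip_e Y12 A *\<^sub>R (p ** Y12)
      + ip_e xi1 A *\<^sub>R (p ** xi1) + ip_e xi2 A *\<^sub>R (p ** xi2)"
    unfolding A(2) by (subst u_alg_expansion[OF A(1)]) (simp add: matrix_mult_linear_simps)
  then have "?g v = f' v"
    by (simp add: linear_add[OF lin(1)] linear_add[OF lin(2)] linear_scale[OF lin(1)]
        linear_scale[OF lin(2)] eq frame_def)
  then show ?thesis by (simp add: ddir_def)
qed

lemma smooth_U2_has_derivative:
  assumes "smooth_U2 f" "p \<in> U2"
  shows "(f has_derivative ddir f p) (at p within U2)"
proof -
  obtain f' where "(f has_derivative f') (at p within U2)"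
    using smooth_U2_extension[OF assms] assms(2) by metis
  then show ?thesis
    unfolding ddir_def by (metis frechet_derivative_works differentiable_def)
qed

lemma smooth_U2_cong:
  assumes "smooth_U2 f" "\<And>p. p \<in> U2 \<Longrightarrow> f p = g p"
  shows "smooth_U2 g"
  unfolding smooth_U2_def
proof
  fix p assume "p \<in> U2"
  with assms(1) obtain S h where "open S" "p \<in> S" "\<forall>k. Ck_on k S h" "\<forall>q\<in>S \<inter> U2. f q = h q"
    unfolding smooth_U2_def by blast
  with assms(2) show "\<exists>S h. open S \<and> p \<in> S \<and> (\<forall>k. Ck_on k S h) \<and> (\<forall>q\<in>S \<inter> U2. g q = h q)"
    by (intro exI[of _ S] exI[of _ h]) simp
qed

lemma smooth_U2_const: "smooth_U2 (\<lambda>q. c)"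
  unfolding smooth_U2_def using Ck_on_const[OF open_UNIV] by blast

lemma smooth_U2_ident: "smooth_U2 (\<lambda>q. q)"
  unfolding smooth_U2_def using Ck_on_ident[OF open_UNIV] by blast

lemma smooth_U2_bounded_linear:
  assumes L: "bounded_linear L" and "smooth_U2 f"
  shows "smooth_U2 (\<lambda>q. L (f q))"
  using assms(2) Ck_on_bounded_linear[OF _ L] unfolding smooth_U2_def by metis

lemma smooth_U2_bounded_bilinear:
  assumes B: "bounded_bilinear B" and f: "smooth_U2 f" and g: "smooth_U2 g"
  shows "smooth_U2 (\<lambda>q. B (f q) (g q))"
  unfolding smooth_U2_def
proof
  fix p assume p: "p \<in> U2"
  obtain S h where S: "open S" "p \<in> S" "\<And>k. Ck_on k S h" "\<And>q. q \<in> S \<Longrightarrow> q \<in> U2 \<Longrightarrow> f q = h q"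
    using smooth_U2_extension[OF f p] by metis
  obtain T l where T: "open T" "p \<in> T" "\<And>k. Ck_on k T l" "\<And>q. q \<in> T \<Longrightarrow> q \<in> U2 \<Longrightarrow> g q = l q"
    using smooth_U2_extension[OF g p] by metis
  have "Ck_on k (S \<inter> T) (\<lambda>q. B (h q) (l q))" for k
    using S T by (intro Ck_on_bounded_bilinear[OF _ B]) (auto intro: Ck_on_mono)
  then show "\<exists>S h. open S \<and> p \<in> S \<and> (\<forall>k. Ck_on k S h) \<and> (\<forall>q\<in>S \<inter> U2. B (f q) (g q) = h q)"
    using S T by (intro exI[of _ "S \<inter> T"] exI[of _ "\<lambda>q. B (h q) (l q)"]) auto
qed

lemma smooth_U2_add:
  assumes f: "smooth_U2 f" and g: "smooth_U2 g"
  shows "smooth_U2 (\<lambda>q. f q + g q)"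
  unfolding smooth_U2_def
proof
  fix p assume p: "p \<in> U2"
  obtain S h where S: "open S" "p \<in> S" "\<And>k. Ck_on k S h" "\<And>q. q \<in> S \<Longrightarrow> q \<in> U2 \<Longrightarrow> f q = h q"
    using smooth_U2_extension[OF f p] by metis
  obtain T l where T: "open T" "p \<in> T" "\<And>k. Ck_on k T l" "\<And>q. q \<in> T \<Longrightarrow> q \<in> U2 \<Longrightarrow> g q = l q"
    using smooth_U2_extension[OF g p] by metis
  have "Ck_on k (S \<inter> T) (\<lambda>q. h q + l q)" for k
    using S T by (intro Ck_on_add) (auto intro: Ck_on_mono)
  then show "\<exists>S h. open S \<and> p \<in> S \<and> (\<forall>k. Ck_on k S h) \<and> (\<forall>q\<in>S \<inter> U2. f q + g q = h q)"
    using S T by (intro exI[of _ "S \<inter> T"] exI[of _ "\<lambda>q. h q + l q"]) auto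
qed

lemma ddir_cong:
  assumes f: "smooth_U2 f" and "\<And>q. q \<in> U2 \<Longrightarrow> f q = g q" and p: "p \<in> U2" "v \<in> tangent p"
  shows "ddir g p v = ddir f p v"
  using smooth_U2_has_derivative[OF f p(1)] assms(2) p
  by (intro ddir_eqI[OF has_derivative_transform[where f=f]]) auto

lemma ddir_const: "p \<in> U2 \<Longrightarrow> v \<in> tangent p \<Longrightarrow> ddir (\<lambda>q. c) p v = 0"
  by (rule ddir_eqI) auto

lemma ddir_ident: "p \<in> U2 \<Longrightarrow> v \<in> tangent p \<Longrightarrow> ddir (\<lambda>q. q) p v = v"
  by (rule ddir_eqI) auto

lemma ddir_add:
  assumes "smooth_U2 f" "smooth_U2 g" "p \<in> U2" "v \<in> tangent p"
  shows "ddir (\<lambda>q. f q + g q) p v = ddir f p v + ddir g p v"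
  using assms by (intro ddir_eqI[OF has_derivative_add] smooth_U2_has_derivative)

lemma ddir_bounded_linear:
  assumes "bounded_linear L" "smooth_U2 f" "p \<in> U2" "v \<in> tangent p"
  shows "ddir (\<lambda>q. L (f q)) p v = L (ddir f p v)"
  using ddir_eqI[OF bounded_linear.has_derivative[OF assms(1) smooth_U2_has_derivative[OF assms(2,3)]] assms(3,4)] .

lemma ddir_bounded_bilinear:
  assumes "bounded_bilinear B" "smooth_U2 f" "smooth_U2 g" "p \<in> U2" "v \<in> tangent p"
  shows "ddir (\<lambda>q. B (f q) (g q)) p v = B (f p) (ddir g p v) + B (ddir f p v) (g p)"
  using ddir_eqI[OF bounded_bilinear.FDERIV[OF assms(1) smooth_U2_has_derivative[OF assms(2,4)]
        smooth_U2_has_derivative[OF assms(3,4)]] assms(4,5)] .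

text \<open>For a fixed map \<open>f\<close>, the derivative of \<open>q \<mapsto> df\<^sub>q(Y(q))\<close> splits into a first-order part and the Hessian \<open>H\<close>
of a local extension. The extension is fixed before \<open>Y\<close>, so that the same symmetric \<open>H\<close> serves two fields at once.\<close>

lemma ddir_derivative_along_field:
  fixes f :: "mat2 \<Rightarrow> 'b::euclidean_space"
  assumes f: "smooth_U2 f" and p: "p \<in> U2"
  obtains D H where "linear D" "\<And>u v. H u v = H v u" "\<And>v. v \<in> tangent p \<Longrightarrow> ddir f p v = D v"
    "\<And>Y. vector_field Y \<Longrightarrow>
      ((\<lambda>q. ddir f q (Y q)) has_derivative (\<lambda>v. D (ddir Y p v) + H (Y p) v)) (at p within U2)"
proof -
  obtain S h where S: "open S" "p \<in> S" and h: "\<And>k. Ck_on k S h"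
    and der: "\<And>q. q \<in> S \<Longrightarrow> q \<in> U2 \<Longrightarrow> (f has_derivative frechet_derivative h (at q)) (at q within U2)"
    using smooth_U2_extension[OF f p] by metis
  let ?D = "\<lambda>q. frechet_derivative h (at q)"
  let ?H = "\<lambda>u v. frechet_derivative (\<lambda>x. ?D x u) (at p) v"
  have lin: "linear (?D q)" if "q \<in> S" for q
    using Ck_on_Suc_has_derivative[OF h that] by (rule has_derivative_linear)
  have sym: "?H u v = ?H v u" for u v
    using second_frechet_derivative_symmetric[OF S h] .
  have C1: "Ck_on (Suc 0) S (\<lambda>x. ?D x u)" for u using h[of "Suc (Suc 0)"] by simp
  have H: "((\<lambda>x. ?D x u) has_derivative ?H u) (at p)" for u
    using Ck_on_Suc_has_derivative[OF C1 S(2)] .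
  show thesis
  proof (rule that[of "?D p" ?H])
    show "linear (?D p)" using lin S by blast
    show "?H u v = ?H v u" for u v using sym .
    show "ddir f p v = ?D p v" if "v \<in> tangent p" for v
      using der[OF S(2) p] p that by (rule ddir_eqI)
    fix Y assume Y: "vector_field Y"
    then have sY: "smooth_U2 Y" by (simp add: vector_field_def)
    obtain d where d: "d > 0" "ball p d \<subseteq> S" using S by (metis openE)
    have expand: "L w = (\<Sum>b\<in>Basis. (w \<bullet> b) *\<^sub>R L b)" if "linear L" for L :: "mat2 \<Rightarrow> 'b" and w
      by (subst euclidean_representation[of w, symmetric])
        (simp add: linear_sum[OF that] linear_scale[OF that] del: euclidean_representation)
    \<comment> \<open>Linearity in the direction taken first is read off from the symmetry.\<close>
    have linH: "linear (\<lambda>u. ?H u v)" for v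
      using has_derivative_linear[OF H[of v]] by (simp only: sym[of _ v])
    have "((\<lambda>q. \<Sum>b\<in>Basis. (Y q \<bullet> b) *\<^sub>R ?D q b) has_derivative
        (\<lambda>v. \<Sum>b\<in>Basis. (Y p \<bullet> b) *\<^sub>R ?H b v + (ddir Y p v \<bullet> b) *\<^sub>R ?D p b)) (at p within U2)"
      by (intro has_derivative_sum has_derivative_scaleR has_derivative_inner_left
          smooth_U2_has_derivative[OF sY p] has_derivative_at_withinI[OF H])
    also have "(\<lambda>v. \<Sum>b\<in>Basis. (Y p \<bullet> b) *\<^sub>R ?H b v + (ddir Y p v \<bullet> b) *\<^sub>R ?D p b)
        = (\<lambda>v. ?D p (ddir Y p v) + ?H (Y p) v)"
    proof
      fix v
      have "?D p (ddir Y p v) = (\<Sum>b\<in>Basis. (ddir Y p v \<bullet> b) *\<^sub>R ?D p b)"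
        "?H (Y p) v = (\<Sum>b\<in>Basis. (Y p \<bullet> b) *\<^sub>R ?H b v)"
        by (rule expand[OF lin[OF S(2)]], rule expand[OF linH])
      then show "(\<Sum>b\<in>Basis. (Y p \<bullet> b) *\<^sub>R ?H b v + (ddir Y p v \<bullet> b) *\<^sub>R ?D p b)
          = ?D p (ddir Y p v) + ?H (Y p) v"
        by (simp only: sum.distrib add.commute)
    qed
    finally show "((\<lambda>q. ddir f q (Y q)) has_derivative (\<lambda>v. ?D p (ddir Y p v) + ?H (Y p) v)) (at p within U2)"
    proof (rule has_derivative_transform_within[OF _ d(1) p])
      fix q assume q: "q \<in> U2" "dist q p < d"
      then have qS: "q \<in> S" using d by (auto simp: subset_iff dist_commute)
      have "ddir f q (Y q) = ?D q (Y q)"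
        using der[OF qS q(1)] q(1) Y by (intro ddir_eqI) (auto simp: vector_field_def)
      then show "(\<Sum>b\<in>Basis. (Y q \<bullet> b) *\<^sub>R ?D q b) = ddir f q (Y q)"
        by (simp only: expand[OF lin[OF qS], of "Y q", symmetric])
    qed
  qed
qed

text \<open>The bracket is defined through matrix-valued derivatives; this says that it acts on functions as the
commutator of derivations. The Hessian terms cancel by symmetry. Tangency of the bracket enters because
\<open>ddir\<close> is only determined on tangent vectors.\<close>

lemma ddir_commutator:
  fixes f :: "mat2 \<Rightarrow> 'b::euclidean_space"
  assumes f: "smooth_U2 f" and X: "vector_field X" and Y: "vector_field Y" and p: "p \<in> U2"
    and b: "bracket X Y p \<in> tangent p"
  shows "ddir (\<lambda>q. ddir f q (Y q)) p (X p) - ddir (\<lambda>q. ddir f q (X q)) p (Y p)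
    = ddir f p (bracket X Y p)"
proof -
  obtain D H where D: "linear D" and H: "\<And>u v. H u v = H v u"
    and df: "\<And>v. v \<in> tangent p \<Longrightarrow> ddir f p v = D v"
    and der: "\<And>Y. vector_field Y \<Longrightarrow>
      ((\<lambda>q. ddir f q (Y q)) has_derivative (\<lambda>v. D (ddir Y p v) + H (Y p) v)) (at p within U2)"
    by (rule ddir_derivative_along_field[OF f p]) auto
  have t: "X p \<in> tangent p" "Y p \<in> tangent p" using X Y p by (auto simp: vector_field_def)
  have "ddir (\<lambda>q. ddir f q (Y q)) p (X p) = D (ddir Y p (X p)) + H (Y p) (X p)"
    using ddir_eqI[OF der[OF Y] p t(1)] .
  moreover have "ddir (\<lambda>q. ddir f q (X q)) p (Y p) = D (ddir X p (Y p)) + H (Y p) (X p)"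
    using ddir_eqI[OF der[OF X] p t(2)] H[of "X p" "Y p"] by simp
  moreover have "ddir f p (bracket X Y p) = D (ddir Y p (X p)) - D (ddir X p (Y p))"
    unfolding df[OF b] by (simp add: bracket_def linear_diff[OF D])
  ultimately show ?thesis by simp
qed

lemma vector_fieldD:
  assumes "vector_field X"
  shows "smooth_U2 X" "p \<in> U2 \<Longrightarrow> X p \<in> tangent p"
  using assms by (auto simp: vector_field_def)

lemma vector_field_cong:
  assumes "vector_field X" "\<And>p. p \<in> U2 \<Longrightarrow> X p = Y p"
  shows "vector_field Y"
  using assms smooth_U2_cong[of X Y] by (auto simp: vector_field_def)

lemma vector_field_add:
  assumes "vector_field X" "vector_field Y"
  shows "vector_field (\<lambda>q. X q + Y q)"
  using assms smooth_U2_add[of X Y] tangent_closed(1) unfolding vector_field_def by blast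

lemma vector_field_scaleR:
  assumes "smooth_U2 f" "vector_field X"
  shows "vector_field (\<lambda>q. f q *\<^sub>R X q)"
  using assms smooth_U2_bounded_bilinear[OF bounded_bilinear_scaleR, of f X] tangent_closed(3)
  unfolding vector_field_def by blast

lemma vector_field_diff:
  assumes "vector_field X" "vector_field Y"
  shows "vector_field (\<lambda>q. X q - Y q)"
  using vector_field_add[OF assms(1) vector_field_scaleR[OF smooth_U2_const[of "- 1"] assms(2)]]
  by simp

lemma vector_field_linv:
  assumes "A \<in> u_alg"
  shows "vector_field (linv A)"
  unfolding vector_field_def linv_def
  using smooth_U2_bounded_bilinear[OF bounded_bilinear_matrix_mult smooth_U2_ident smooth_U2_const]
    tangent_linv[OF assms] by blast

section \<open>The connection in the left trivialisation\<close>

definition ltriv :: "(mat2 \<Rightarrow> mat2) \<Rightarrow> mat2 \<Rightarrow> mat2" where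
  "ltriv X q = herm_adj q ** X q"

text \<open>The form \<open>- (\<eta>\<^sub>1 + \<eta>\<^sub>2)\<close> at the identity; the connection turns out to be \<open>d + conn_form \<otimes> phi_alg\<close>.\<close>

definition conn_form :: "mat2 \<Rightarrow> real" where
  "conn_form A = - (ip_e xi1 A + ip_e xi2 A)"

definition phi_alg :: "mat2 \<Rightarrow> mat2" where
  "phi_alg A = ip_e X12 A *\<^sub>R Y12 - ip_e Y12 A *\<^sub>R X12"

text \<open>The exterior derivative of the left-invariant extension of \<open>conn_form\<close>.\<close>

definition curv_form :: "mat2 \<Rightarrow> mat2 \<Rightarrow> real" where
  "curv_form A B = - conn_form (A ** B - B ** A)"

lemma bounded_bilinear_ip_e: "bounded_bilinear ip_e"
  unfolding bilinear_conv_bounded_bilinear[symmetric] bilinear_def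
  by (auto intro!: linearI simp: ip_e_def algebra_simps)

lemmas ip_e_linear_simps =
  bounded_bilinear.add_left[OF bounded_bilinear_ip_e] bounded_bilinear.add_right[OF bounded_bilinear_ip_e]
  bounded_bilinear.diff_left[OF bounded_bilinear_ip_e] bounded_bilinear.diff_right[OF bounded_bilinear_ip_e]
  bounded_bilinear.scaleR_left[OF bounded_bilinear_ip_e] bounded_bilinear.scaleR_right[OF bounded_bilinear_ip_e]

lemma ip_e_commute: "ip_e A B = ip_e B A"
  by (simp add: ip_e_def mult.commute)

lemma bounded_linear_conn_form: "bounded_linear conn_form"
  unfolding linear_conv_bounded_linear[symmetric]
  by (auto intro!: linearI simp: conn_form_def ip_e_linear_simps algebra_simps)

lemma bounded_linear_phi_alg: "bounded_linear phi_alg"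
  unfolding linear_conv_bounded_linear[symmetric]
  by (auto intro!: linearI simp: phi_alg_def ip_e_linear_simps algebra_simps)

lemmas conn_form_linear_simps =
  linear_add[OF bounded_linear.linear[OF bounded_linear_conn_form]]
  linear_diff[OF bounded_linear.linear[OF bounded_linear_conn_form]]
  linear_scale[OF bounded_linear.linear[OF bounded_linear_conn_form]]

lemmas phi_alg_linear_simps =
  linear_add[OF bounded_linear.linear[OF bounded_linear_phi_alg]]
  linear_diff[OF bounded_linear.linear[OF bounded_linear_phi_alg]]
  linear_scale[OF bounded_linear.linear[OF bounded_linear_phi_alg]]

lemma bounded_bilinear_curv_form: "bounded_bilinear curv_form"
  unfolding bilinear_conv_bounded_bilinear[symmetric] bilinear_def
  by (auto intro!: linearI
      simp: curv_form_def conn_form_linear_simps matrix_mult_linear_simps algebra_simps)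

lemmas curv_form_linear_simps =
  bounded_bilinear.add_left[OF bounded_bilinear_curv_form]
  bounded_bilinear.add_right[OF bounded_bilinear_curv_form]
  bounded_bilinear.scaleR_left[OF bounded_bilinear_curv_form]
  bounded_bilinear.scaleR_right[OF bounded_bilinear_curv_form]

lemma phi_alg_u_alg: "phi_alg A \<in> u_alg"
  by (simp add: phi_alg_def u_alg_closed frame_u_alg)

lemma u_alg_entries:
  fixes A :: mat2
  assumes "A \<in> u_alg"
  shows "Re (A $ 1 $ 1) = 0" "Re (A $ 2 $ 2) = 0" "Re (A $ 2 $ 1) = - Re (A $ 1 $ 2)"
    "Im (A $ 2 $ 1) = Im (A $ 1 $ 2)"
proof -
  have "cnj (A $ j $ i) = - A $ i $ j" for i j
    using assms by (simp add: u_alg_def herm_adj_def vec_eq_iff)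
  then have "Re (cnj (A $ j $ i)) = Re (- A $ i $ j)" "Im (cnj (A $ j $ i)) = Im (- A $ i $ j)" for i j
    by simp_all
  from this(1)[of 1 1] this(1)[of 2 2] this(1)[of 2 1] this(2)[of 2 1]
  show "Re (A $ 1 $ 1) = 0" "Re (A $ 2 $ 2) = 0" "Re (A $ 2 $ 1) = - Re (A $ 1 $ 2)"
    "Im (A $ 2 $ 1) = Im (A $ 1 $ 2)" unfolding cnj.sel uminus_complex.sel by linarith+
qed

text \<open>Infinitesimal invariance of the curvature form under the rotations generated by \<open>phi_alg\<close>; this is
what makes the curvature parallel.\<close>

lemma curv_form_phi_alg:
  assumes "A \<in> u_alg" "B \<in> u_alg"
  shows "curv_form (phi_alg A) B + curv_form A (phi_alg B) = 0"
  by (simp add: curv_form_def conn_form_def phi_alg_def ip_e_def matrix_matrix_mult_def sum_2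
      u_alg_entries[OF assms(1)] u_alg_entries[OF assms(2)] algebra_simps)

lemma u_alg_eqI:
  assumes "A \<in> u_alg" "B \<in> u_alg" "\<And>C. C \<in> u_alg \<Longrightarrow> ip_e A C = ip_e B C"
  shows "A = B"
  by (rule trans[OF u_alg_expansion[OF assms(1)] trans[OF _ u_alg_expansion[OF assms(2), symmetric]]])
    (simp add: ip_e_commute[of _ A] ip_e_commute[of _ B] assms(3) frame_u_alg)

lemma ltriv_u_alg: "vector_field X \<Longrightarrow> p \<in> U2 \<Longrightarrow> ltriv X p \<in> u_alg"
  using vector_fieldD(2) by (simp add: ltriv_def tangent_iff)

lemma ltriv_inverse: "p \<in> U2 \<Longrightarrow> p ** ltriv X p = X p"
  by (simp add: ltriv_def U2_cancel)

lemma smooth_U2_ltriv: "vector_field X \<Longrightarrow> smooth_U2 (ltriv X)"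
  unfolding ltriv_def
  using smooth_U2_bounded_bilinear[OF bounded_bilinear_matrix_mult
      smooth_U2_bounded_linear[OF bounded_linear_herm_adj smooth_U2_ident] vector_fieldD(1)] .

lemma ddir_u_alg:
  assumes "smooth_U2 f" "\<And>q. q \<in> U2 \<Longrightarrow> f q \<in> u_alg" "p \<in> U2" "v \<in> tangent p"
  shows "ddir f p v \<in> u_alg"
proof -
  have s: "smooth_U2 (\<lambda>q. herm_adj (f q))"
    using smooth_U2_bounded_linear[OF bounded_linear_herm_adj assms(1)] .
  have "herm_adj (ddir f p v) + ddir f p v = ddir (\<lambda>q. herm_adj (f q) + f q) p v"
    using ddir_add[OF s assms(1,3,4)] ddir_bounded_linear[OF bounded_linear_herm_adj assms(1,3,4)]
    by simp
  also have "\<dots> = ddir (\<lambda>q. 0) p v"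
    using assms(2) by (intro ddir_cong[OF smooth_U2_const _ assms(3,4)]) (simp add: u_alg_def)
  also have "\<dots> = 0" using assms(3,4) by (rule ddir_const)
  finally show ?thesis by (simp add: u_alg_def eq_neg_iff_add_eq_0)
qed

lemma ddir_ltriv:
  assumes X: "vector_field X" and p: "p \<in> U2" and v: "v \<in> tangent p"
  shows "ddir X p v = p ** ddir (ltriv X) p v + v ** ltriv X p"
proof -
  have s: "smooth_U2 (\<lambda>q. q ** ltriv X q)"
    using smooth_U2_bounded_bilinear[OF bounded_bilinear_matrix_mult smooth_U2_ident smooth_U2_ltriv[OF X]] .
  have "ddir X p v = ddir (\<lambda>q. q ** ltriv X q) p v"
    using p v by (intro ddir_cong[OF s]) (simp_all add: ltriv_inverse)
  then show ?thesis
    using ddir_bounded_bilinear[OF bounded_bilinear_matrix_mult smooth_U2_ident smooth_U2_ltriv[OF X] p v]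
    by (simp add: ddir_ident[OF p v])
qed

lemma ltriv_bracket:
  assumes X: "vector_field X" and Y: "vector_field Y" and p: "p \<in> U2"
  shows "ltriv (bracket X Y) p = ltriv X p ** ltriv Y p - ltriv Y p ** ltriv X p
    + ddir (ltriv Y) p (X p) - ddir (ltriv X) p (Y p)"
proof -
  have "bracket X Y p = p ** ddir (ltriv Y) p (X p) + X p ** ltriv Y p
      - (p ** ddir (ltriv X) p (Y p) + Y p ** ltriv X p)"
    using X Y p by (simp add: bracket_def ddir_ltriv vector_fieldD)
  then show ?thesis
    by (simp add: ltriv_def matrix_mult_linear_simps U2_inverse[OF p] matrix_mul_assoc)
qed

lemma ltriv_linv: "p \<in> U2 \<Longrightarrow> ltriv (linv A) p = A"
  by (simp add: ltriv_def linv_def U2_cancel)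

lemma ddir_ltriv_linv: "A \<in> u_alg \<Longrightarrow> p \<in> U2 \<Longrightarrow> v \<in> tangent p \<Longrightarrow> ddir (ltriv (linv A)) p v = 0"
  using ddir_cong[OF smooth_U2_const[of A], of "ltriv (linv A)" p v]
  by (simp add: ltriv_linv ddir_const)

lemma bracket_linv:
  assumes "A \<in> u_alg" "B \<in> u_alg" "p \<in> U2"
  shows "bracket (linv A) (linv B) p = linv (A ** B - B ** A) p"
proof -
  have "ltriv (bracket (linv A) (linv B)) p = A ** B - B ** A"
    using assms ltriv_bracket[OF vector_field_linv[OF assms(1)] vector_field_linv[OF assms(2)] assms(3)]
    by (simp add: ltriv_linv ddir_ltriv_linv vector_fieldD(2)[OF vector_field_linv])
  then show ?thesis using ltriv_inverse[OF assms(3)] by (metis linv_def)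
qed

lemma affine_connectionD:
  assumes "affine_connection D"
  shows "vector_field X \<Longrightarrow> vector_field Y \<Longrightarrow> vector_field (D X Y)"
    "vector_field X \<Longrightarrow> vector_field X' \<Longrightarrow> vector_field Y \<Longrightarrow> p \<in> U2 \<Longrightarrow>
      D (\<lambda>q. X q + X' q) Y p = D X Y p + D X' Y p"
    "smooth_U2 f \<Longrightarrow> vector_field X \<Longrightarrow> vector_field Y \<Longrightarrow> p \<in> U2 \<Longrightarrow>
      D (\<lambda>q. f q *\<^sub>R X q) Y p = f p *\<^sub>R D X Y p"
    "vector_field X \<Longrightarrow> vector_field Y \<Longrightarrow> vector_field Y' \<Longrightarrow> p \<in> U2 \<Longrightarrow>
      D X (\<lambda>q. Y q + Y' q) p = D X Y p + D X Y' p"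
    "smooth_U2 f \<Longrightarrow> vector_field X \<Longrightarrow> vector_field Y \<Longrightarrow> p \<in> U2 \<Longrightarrow>
      D X (\<lambda>q. f q *\<^sub>R Y q) p = ddir f p (X p) *\<^sub>R Y p + f p *\<^sub>R D X Y p"
  by (fact assms[unfolded affine_connection_def, THEN conjunct1, rule_format]
      assms[unfolded affine_connection_def, THEN conjunct2, THEN conjunct1, rule_format]
      assms[unfolded affine_connection_def, THEN conjunct2, THEN conjunct2, THEN conjunct1, rule_format]
      assms[unfolded affine_connection_def, THEN conjunct2, THEN conjunct2, THEN conjunct2,
        THEN conjunct1, rule_format]
      assms[unfolded affine_connection_def, THEN conjunct2, THEN conjunct2, THEN conjunct2,
        THEN conjunct2, rule_format])+

text \<open>Vector fields are total functions on matrices, so it has to be shown that a connection cannot see their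
values outside U(2).\<close>

lemma affine_connection_cong:
  assumes D: "affine_connection D" and V: "vector_field X" "vector_field X'" "vector_field Y"
    and eq: "\<And>q. q \<in> U2 \<Longrightarrow> X q = X' q" and p: "p \<in> U2"
  shows "D X Y p = D X' Y p" "D Y X p = D Y X' p"
proof -
  \<comment> \<open>The difference \<open>Z\<close> vanishes on U(2) and so is unchanged by multiplication with this smooth function.\<close>
  define f :: "mat2 \<Rightarrow> real" where "f q = (if q \<in> U2 then 0 else 1)" for q
  define Z where "Z q = X q - X' q" for q
  have f: "smooth_U2 f" using smooth_U2_const[of 0] by (rule smooth_U2_cong) (simp add: f_def)
  have Z: "vector_field Z" unfolding Z_def using V(1,2) by (rule vector_field_diff)
  have fp: "f p = 0" "Z p = 0" using p by (simp_all add: f_def Z_def eq)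
  have "f q *\<^sub>R Z q = Z q" for q by (simp add: f_def Z_def eq)
  then have fZ: "(\<lambda>q. f q *\<^sub>R Z q) = Z" by blast
  have "(\<lambda>q. X' q + Z q) = X" by (simp add: Z_def)
  moreover have "D Z Y p = 0"
    using affine_connectionD(3)[OF D f Z V(3) p] by (simp add: fZ fp)
  moreover have "D Y Z p = 0"
    using affine_connectionD(5)[OF D f V(3) Z p] by (simp add: fZ fp)
  ultimately show "D X Y p = D X' Y p" "D Y X p = D Y X' p"
    using affine_connectionD(2)[OF D V(2) Z V(3) p] affine_connectionD(4)[OF D V(3,2) Z p] by simp_all
qed

text \<open>The combination agrees with \<open>X\<close> only on U(2); hence the separate claim that it is a vector field.\<close>

lemma frame_field_expansion:
  assumes X: "vector_field X"
  defines "c \<equiv> \<lambda>E q. ip_e E (ltriv X q)"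
  defines "X' \<equiv> \<lambda>q. c X12 q *\<^sub>R linv X12 q + c Y12 q *\<^sub>R linv Y12 q
    + c xi1 q *\<^sub>R linv xi1 q + c xi2 q *\<^sub>R linv xi2 q"
  shows "\<And>E. smooth_U2 (c E)" "vector_field X'" "\<And>q. q \<in> U2 \<Longrightarrow> X q = X' q"
proof -
  show c: "smooth_U2 (c E)" for E
    unfolding c_def
    using smooth_U2_bounded_bilinear[OF bounded_bilinear_ip_e smooth_U2_const smooth_U2_ltriv[OF X]] .
  show "vector_field X'"
    unfolding X'_def by (intro vector_field_add vector_field_scaleR c vector_field_linv frame_u_alg)
  show "X q = X' q" if q: "q \<in> U2" for q
  proof -
    have "X q = q ** ltriv X q" using q by (simp add: ltriv_inverse)
    also have "\<dots> = X' q"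
      by (subst u_alg_expansion[OF ltriv_u_alg[OF X q]])
        (simp add: X'_def c_def linv_def matrix_mult_linear_simps)
    finally show ?thesis .
  qed
qed

lemma affine_connection_left_expansion:
  assumes D: "affine_connection D" and X: "vector_field X" and Y: "vector_field Y" and p: "p \<in> U2"
  defines "c \<equiv> \<lambda>E. ip_e E (ltriv X p)"
  shows "D X Y p = c X12 *\<^sub>R D (linv X12) Y p + c Y12 *\<^sub>R D (linv Y12) Y p
    + c xi1 *\<^sub>R D (linv xi1) Y p + c xi2 *\<^sub>R D (linv xi2) Y p"
proof -
  let ?c = "\<lambda>E q. ip_e E (ltriv X q)"
  note ex = frame_field_expansion[OF X]
  note L = vector_field_linv[OF frame_u_alg(1)] vector_field_linv[OF frame_u_alg(2)]
      vector_field_linv[OF frame_u_alg(3)] vector_field_linv[OF frame_u_alg(4)]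
  note S = vector_field_scaleR[OF ex(1) L(1)] vector_field_scaleR[OF ex(1) L(2)]
    vector_field_scaleR[OF ex(1) L(3)] vector_field_scaleR[OF ex(1) L(4)]
  note A = vector_field_add[OF S(1,2)] vector_field_add[OF vector_field_add[OF S(1,2)] S(3)]
  have eq: "D X Y p = D (\<lambda>q. ?c X12 q *\<^sub>R linv X12 q + ?c Y12 q *\<^sub>R linv Y12 q
    + ?c xi1 q *\<^sub>R linv xi1 q + ?c xi2 q *\<^sub>R linv xi2 q) Y p"
    using ex(3) by (rule affine_connection_cong(1)[OF D X ex(2) Y _ p])
  show ?thesis
    unfolding eq c_def
    by (simp add: affine_connectionD(2)[OF D A(2) S(4) Y p] affine_connectionD(2)[OF D A(1) S(3) Y p]
        affine_connectionD(2)[OF D S(1,2) Y p] affine_connectionD(3)[OF D ex(1) L(1) Y p]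
        affine_connectionD(3)[OF D ex(1) L(2) Y p] affine_connectionD(3)[OF D ex(1) L(3) Y p]
        affine_connectionD(3)[OF D ex(1) L(4) Y p])
qed

lemma affine_connection_right_expansion:
  assumes D: "affine_connection D" and X: "vector_field X" and Y: "vector_field Y" and p: "p \<in> U2"
  defines "c \<equiv> \<lambda>E. ip_e E (ltriv Y p)"
  shows "D X Y p = p ** ddir (ltriv Y) p (X p)
    + (c X12 *\<^sub>R D X (linv X12) p + c Y12 *\<^sub>R D X (linv Y12) p
      + c xi1 *\<^sub>R D X (linv xi1) p + c xi2 *\<^sub>R D X (linv xi2) p)"
proof -
  let ?c = "\<lambda>E q. ip_e E (ltriv Y q)"
  let ?d = "\<lambda>E. ip_e E (ddir (ltriv Y) p (X p))"
  note ex = frame_field_expansion[OF Y]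
  note L = vector_field_linv[OF frame_u_alg(1)] vector_field_linv[OF frame_u_alg(2)]
      vector_field_linv[OF frame_u_alg(3)] vector_field_linv[OF frame_u_alg(4)]
  note S = vector_field_scaleR[OF ex(1) L(1)] vector_field_scaleR[OF ex(1) L(2)]
    vector_field_scaleR[OF ex(1) L(3)] vector_field_scaleR[OF ex(1) L(4)]
  note A = vector_field_add[OF S(1,2)] vector_field_add[OF vector_field_add[OF S(1,2)] S(3)]
  have t: "X p \<in> tangent p" using X p by (rule vector_fieldD)
  have dc: "ddir (?c E) p (X p) = ?d E" for E
    using ddir_bounded_linear[OF bounded_bilinear.bounded_linear_right[OF bounded_bilinear_ip_e]
        smooth_U2_ltriv[OF Y] p t] .
  have "ddir (ltriv Y) p (X p) \<in> u_alg"
    using ddir_u_alg[OF smooth_U2_ltriv[OF Y] ltriv_u_alg[OF Y] p t] .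
  from u_alg_expansion[OF this]
  have "p ** ddir (ltriv Y) p (X p) = p ** (?d X12 *\<^sub>R X12 + ?d Y12 *\<^sub>R Y12 + ?d xi1 *\<^sub>R xi1 + ?d xi2 *\<^sub>R xi2)"
    by (rule arg_cong)
  also have "\<dots> = ?d X12 *\<^sub>R linv X12 p + ?d Y12 *\<^sub>R linv Y12 p + ?d xi1 *\<^sub>R linv xi1 p + ?d xi2 *\<^sub>R linv xi2 p"
    by (simp add: linv_def matrix_mult_linear_simps)
  finally have d: "p ** ddir (ltriv Y) p (X p)
    = ?d X12 *\<^sub>R linv X12 p + ?d Y12 *\<^sub>R linv Y12 p + ?d xi1 *\<^sub>R linv xi1 p + ?d xi2 *\<^sub>R linv xi2 p" .
  have eq: "D X Y p = D X (\<lambda>q. ?c X12 q *\<^sub>R linv X12 q + ?c Y12 q *\<^sub>R linv Y12 q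
    + ?c xi1 q *\<^sub>R linv xi1 q + ?c xi2 q *\<^sub>R linv xi2 q) p"
    using ex(3) by (rule affine_connection_cong(2)[OF D Y ex(2) X _ p])
  show ?thesis
    unfolding eq c_def d
    by (simp add: affine_connectionD(4)[OF D X A(2) S(4) p] affine_connectionD(4)[OF D X A(1) S(3) p]
        affine_connectionD(4)[OF D X S(1,2) p] affine_connectionD(5)[OF D ex(1) X L(1) p]
        affine_connectionD(5)[OF D ex(1) X L(2) p] affine_connectionD(5)[OF D ex(1) X L(3) p]
        affine_connectionD(5)[OF D ex(1) X L(4) p] dc)
qed

text \<open>The Koszul formula for left-invariant fields, whose inner products are constant. The three cyclic
instances of torsion-freeness and of metricity combine linearly.\<close>

lemma levi_civita_linv:
  assumes LC: "levi_civita D" and u: "A \<in> u_alg" "B \<in> u_alg" "C \<in> u_alg" and p: "p \<in> U2"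
  shows "2 * lmetric p (D (linv A) (linv B) p) (linv C p)
    = ip_e (A ** B - B ** A) C - ip_e (B ** C - C ** B) A + ip_e (C ** A - A ** C) B"
proof -
  let ?g = "\<lambda>A B C. lmetric p (D (linv A) (linv B) p) (linv C p)"
  note L = vector_field_linv
  have tor: "?g A B C - ?g B A C = ip_e (A ** B - B ** A) C"
    if u: "A \<in> u_alg" "B \<in> u_alg" for A B C
  proof -
    have "D (linv A) (linv B) p - D (linv B) (linv A) p = linv (A ** B - B ** A) p"
      using LC L[OF u(1)] L[OF u(2)] p bracket_linv[OF u p] unfolding levi_civita_def by auto
    then have "lmetric p (D (linv A) (linv B) p - D (linv B) (linv A) p) (linv C p) = ip_e (A ** B - B ** A) C"
      by (simp add: lmetric_linv p)
    then show ?thesis by (simp add: lmetric_def matrix_mult_linear_simps ip_e_linear_simps)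
  qed
  have met: "?g A B C + ?g A C B = 0"
    if u: "A \<in> u_alg" "B \<in> u_alg" "C \<in> u_alg" for A B C
  proof -
    have "ddir (\<lambda>q. lmetric q (linv B q) (linv C q)) p (linv A p)
        = ?g A B C + lmetric p (linv B p) (D (linv A) (linv C) p)"
      using LC L[OF u(1)] L[OF u(2)] L[OF u(3)] p unfolding levi_civita_def by blast
    moreover have "ddir (\<lambda>q. lmetric q (linv B q) (linv C q)) p (linv A p) = 0"
      using ddir_cong[OF smooth_U2_const[of "ip_e B C"] _ p vector_fieldD(2)[OF L[OF u(1)] p]]
      by (simp add: lmetric_linv ddir_const p vector_fieldD(2)[OF L[OF u(1)]])
    ultimately show ?thesis by (simp add: lmetric_def ip_e_commute)
  qed
  show ?thesis
    using tor[OF u(1,2), of C] tor[OF u(2,3), of A] tor[OF u(3,1), of B]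
      met[OF u] met[OF u(2,3,1)] met[OF u(3,1,2)] by linarith
qed

lemma torsion_form_linv:
  assumes p: "p \<in> U2"
  shows "torsion_form p (linv A p) (linv B p) (linv C p)
    = - 2 * (conn_form A * ip_e B (phi_alg C) - conn_form B * ip_e A (phi_alg C)
        + conn_form C * ip_e A (phi_alg B))"
proof -
  have phi: "phi p (linv B p) = linv (phi_alg B) p" for B
    unfolding phi_def lmetric_linv[OF p]
    by (simp add: phi_alg_def linv_def matrix_mult_linear_simps)
  show ?thesis
    by (simp add: torsion_form_def wedge_def eta1_def eta2_def F_def phi lmetric_linv[OF p]
        conn_form_def algebra_simps)
qed

locale skew_torsion_connection =
  fixes nablaG nabla :: "(mat2 \<Rightarrow> mat2) \<Rightarrow> (mat2 \<Rightarrow> mat2) \<Rightarrow> mat2 \<Rightarrow> mat2"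
  assumes levi_civita: "levi_civita nablaG"
    and affine: "affine_connection nabla"
    and torsion: "\<And>X Y Z p. vector_field X \<Longrightarrow> vector_field Y \<Longrightarrow> vector_field Z \<Longrightarrow> p \<in> U2 \<Longrightarrow>
      lmetric p (nabla X Y p) (Z p)
        = lmetric p (nablaG X Y p) (Z p) + 1 / 2 * torsion_form p (X p) (Y p) (Z p)"
begin

text \<open>Inserting the brackets into the Koszul formula and adding the torsion form leaves only the term in which
the direction of differentiation enters through \<open>\<eta>\<^sub>1 + \<eta>\<^sub>2\<close>. Since both sides are polynomial in the entries
of \<open>A, B, C\<close>, the identity is checked on entries.\<close>

lemma nabla_linv:
  assumes u: "A \<in> u_alg" "B \<in> u_alg" and p: "p \<in> U2"
  shows "nabla (linv A) (linv B) p = linv (conn_form A *\<^sub>R phi_alg B) p"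
proof -
  have "vector_field (nabla (linv A) (linv B))"
    using affine_connectionD(1)[OF affine vector_field_linv[OF u(1)] vector_field_linv[OF u(2)]] .
  then obtain V where V: "V \<in> u_alg" "nabla (linv A) (linv B) p = p ** V"
    using tangentE[OF vector_fieldD(2)[OF _ p]] by blast
  have "V = conn_form A *\<^sub>R phi_alg B"
  proof (rule u_alg_eqI[OF V(1)])
    show "conn_form A *\<^sub>R phi_alg B \<in> u_alg" by (simp add: u_alg_closed phi_alg_u_alg)
    fix C :: mat2 assume C: "C \<in> u_alg"
    have "2 * ip_e V C = 2 * lmetric p (nabla (linv A) (linv B) p) (linv C p)"
      using lmetric_linv[OF p, of V C] V(2) by (simp add: linv_def)
    also have "\<dots> = ip_e (A ** B - B ** A) C - ip_e (B ** C - C ** B) A + ip_e (C ** A - A ** C) B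
      - 2 * (conn_form A * ip_e B (phi_alg C) - conn_form B * ip_e A (phi_alg C)
        + conn_form C * ip_e A (phi_alg B))"
      using torsion[OF vector_field_linv[OF u(1)] vector_field_linv[OF u(2)] vector_field_linv[OF C] p]
        levi_civita_linv[OF levi_civita u C p] by (simp add: torsion_form_linv[OF p])
    also have "\<dots> = 2 * ip_e (conn_form A *\<^sub>R phi_alg B) C"
      by (simp add: conn_form_def phi_alg_def ip_e_def matrix_matrix_mult_def sum_2
          u_alg_entries[OF u(1)] u_alg_entries[OF u(2)] u_alg_entries[OF C] algebra_simps)
    finally show "ip_e V C = ip_e (conn_form A *\<^sub>R phi_alg B) C" by simp
  qed
  with V(2) show ?thesis by (simp add: linv_def)
qed

lemma ltriv_nabla:
  assumes X: "vector_field X" and Y: "vector_field Y" and p: "p \<in> U2"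
  shows "ltriv (nabla X Y) p
    = ddir (ltriv Y) p (X p) + conn_form (ltriv X p) *\<^sub>R phi_alg (ltriv Y p)"
proof -
  have 1: "nabla X (linv E) p = p ** (conn_form (ltriv X p) *\<^sub>R phi_alg E)" if E: "E \<in> u_alg" for E
  proof -
    let ?x = "ltriv X p"
    have "conn_form ?x = conn_form (ip_e X12 ?x *\<^sub>R X12 + ip_e Y12 ?x *\<^sub>R Y12 + ip_e xi1 ?x *\<^sub>R xi1
        + ip_e xi2 ?x *\<^sub>R xi2)"
      using u_alg_expansion[OF ltriv_u_alg[OF X p]] by (rule arg_cong)
    then show ?thesis
      using affine_connection_left_expansion[OF affine X vector_field_linv[OF E] p]
      by (simp add: nabla_linv[OF _ E p] frame_u_alg linv_def matrix_mult_linear_simps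
          conn_form_linear_simps scaleR_add_left)
  qed
  let ?y = "ltriv Y p"
  have "phi_alg ?y = phi_alg (ip_e X12 ?y *\<^sub>R X12 + ip_e Y12 ?y *\<^sub>R Y12 + ip_e xi1 ?y *\<^sub>R xi1
      + ip_e xi2 ?y *\<^sub>R xi2)"
    using u_alg_expansion[OF ltriv_u_alg[OF Y p]] by (rule arg_cong)
  then have "nabla X Y p = p ** (ddir (ltriv Y) p (X p) + conn_form (ltriv X p) *\<^sub>R phi_alg ?y)"
    using affine_connection_right_expansion[OF affine X Y p]
    by (simp add: 1 frame_u_alg matrix_mult_linear_simps phi_alg_linear_simps scaleR_add_right ac_simps)
  then show ?thesis by (simp add: ltriv_def[of "nabla X Y"] U2_cancel[OF p])
qed

lemma vector_field_nabla: "vector_field X \<Longrightarrow> vector_field Y \<Longrightarrow> vector_field (nabla X Y)"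
  by (rule affine_connectionD(1)[OF affine])

text \<open>Smoothness and tangency come for free from the torsion-free connection.\<close>

lemma vector_field_bracket:
  assumes "vector_field X" "vector_field Y"
  shows "vector_field (bracket X Y)"
proof (rule vector_field_cong)
  have "affine_connection nablaG" using levi_civita by (simp add: levi_civita_def)
  then show "vector_field (\<lambda>q. nablaG X Y q - nablaG Y X q)"
    using assms by (intro vector_field_diff) (simp_all add: affine_connectionD(1))
  show "nablaG X Y p - nablaG Y X p = bracket X Y p" if "p \<in> U2" for p
    using levi_civita assms that unfolding levi_civita_def by blast
qed

lemma ddir_ltriv_nabla:
  assumes W: "vector_field W" and X: "vector_field X" and Z: "vector_field Z" and p: "p \<in> U2"
  shows "ddir (ltriv (nabla X Z)) p (W p) = ddir (\<lambda>q. ddir (ltriv Z) q (X q)) p (W p)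
    + (conn_form (ltriv X p) *\<^sub>R phi_alg (ddir (ltriv Z) p (W p))
      + conn_form (ddir (ltriv X) p (W p)) *\<^sub>R phi_alg (ltriv Z p))"
proof -
  have t: "W p \<in> tangent p" using W p by (rule vector_fieldD)
  let ?b = "\<lambda>q. conn_form (ltriv X q) *\<^sub>R phi_alg (ltriv Z q)"
  note c = smooth_U2_bounded_linear[OF bounded_linear_conn_form smooth_U2_ltriv[OF X]]
  note f = smooth_U2_bounded_linear[OF bounded_linear_phi_alg smooth_U2_ltriv[OF Z]]
  have b: "smooth_U2 ?b" using smooth_U2_bounded_bilinear[OF bounded_bilinear_scaleR c f] .
  note N = smooth_U2_ltriv[OF vector_field_nabla[OF X Z]]
  have "smooth_U2 (\<lambda>q. ltriv (nabla X Z) q + (- 1) *\<^sub>R ?b q)"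
    using smooth_U2_add[OF N smooth_U2_bounded_linear[OF bounded_linear_scaleR_right b]] .
  then have d: "smooth_U2 (\<lambda>q. ddir (ltriv Z) q (X q))"
    by (rule smooth_U2_cong) (simp add: ltriv_nabla[OF X Z])
  have "ddir (ltriv (nabla X Z)) p (W p) = ddir (\<lambda>q. ddir (ltriv Z) q (X q) + ?b q) p (W p)"
    by (rule ddir_cong[OF smooth_U2_add[OF d b] _ p t]) (simp add: ltriv_nabla[OF X Z])
  then show ?thesis
    by (simp add: ddir_add[OF d b p t] ddir_bounded_bilinear[OF bounded_bilinear_scaleR c f p t]
        ddir_bounded_linear[OF bounded_linear_conn_form smooth_U2_ltriv[OF X] p t]
        ddir_bounded_linear[OF bounded_linear_phi_alg smooth_U2_ltriv[OF Z] p t])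
qed

text \<open>The terms quadratic in the connection form cancel since they all involve the same endomorphism, and the
second derivatives of \<open>z\<close> are absorbed by the bracket term. What is left is the exterior derivative
of the connection form.\<close>

lemma ltriv_curvature:
  assumes X: "vector_field X" and Y: "vector_field Y" and Z: "vector_field Z" and p: "p \<in> U2"
  shows "ltriv (curvature nabla X Y Z) p
    = curv_form (ltriv X p) (ltriv Y p) *\<^sub>R phi_alg (ltriv Z p)"
proof -
  note B = vector_field_bracket[OF X Y]
  have "ltriv (curvature nabla X Y Z) p = ltriv (nabla X (nabla Y Z)) p - ltriv (nabla Y (nabla X Z)) p
      - ltriv (nabla (bracket X Y) Z) p"
    by (simp add: curvature_def ltriv_def matrix_mult_linear_simps)
  then show ?thesis
    by (simp add: ltriv_nabla[OF X vector_field_nabla[OF Y Z] p] ltriv_nabla[OF Y vector_field_nabla[OF X Z] p]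
        ltriv_nabla[OF B Z p] ltriv_nabla[OF Y Z p] ltriv_nabla[OF X Z p]
        ddir_ltriv_nabla[OF X Y Z p] ddir_ltriv_nabla[OF Y X Z p] ltriv_bracket[OF X Y p]
        ddir_commutator[OF smooth_U2_ltriv[OF Z] X Y p vector_fieldD(2)[OF B p], symmetric]
        curv_form_def conn_form_linear_simps phi_alg_linear_simps algebra_simps)
qed

lemma parallel_curvature: "parallel_curvature nabla"
  unfolding parallel_curvature_def
proof (intro allI impI ballI)
  fix W X Y Z p
  assume W: "vector_field W" and X: "vector_field X" and Y: "vector_field Y" and Z: "vector_field Z"
    and p: "p \<in> (U2 :: mat2 set)"
  let ?K = "curvature nabla X Y Z" and ?w = "conn_form (ltriv W p)"
  have K: "vector_field ?K"
    unfolding curvature_def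
    by (intro vector_field_diff vector_field_nabla vector_field_bracket X Y Z)
  have t: "W p \<in> tangent p" using W p by (rule vector_fieldD)
  note sX = smooth_U2_ltriv[OF X] and sY = smooth_U2_ltriv[OF Y] and sZ = smooth_U2_ltriv[OF Z]
  note c = smooth_U2_bounded_bilinear[OF bounded_bilinear_curv_form sX sY]
  note f = smooth_U2_bounded_linear[OF bounded_linear_phi_alg sZ]
  have "ddir (ltriv ?K) p (W p) = ddir (\<lambda>q. curv_form (ltriv X q) (ltriv Y q) *\<^sub>R phi_alg (ltriv Z q)) p (W p)"
    by (rule ddir_cong[OF smooth_U2_bounded_bilinear[OF bounded_bilinear_scaleR c f] _ p t])
      (simp add: ltriv_curvature[OF X Y Z])
  also have "\<dots> = curv_form (ltriv X p) (ltriv Y p) *\<^sub>R phi_alg (ddir (ltriv Z) p (W p))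
    + (curv_form (ltriv X p) (ddir (ltriv Y) p (W p)) + curv_form (ddir (ltriv X) p (W p)) (ltriv Y p))
      *\<^sub>R phi_alg (ltriv Z p)"
    by (simp add: ddir_bounded_bilinear[OF bounded_bilinear_scaleR c f p t]
        ddir_bounded_bilinear[OF bounded_bilinear_curv_form sX sY p t]
        ddir_bounded_linear[OF bounded_linear_phi_alg sZ p t])
  finally have dK: "ddir (ltriv ?K) p (W p) = \<dots>" .
  have inv: "curv_form (ltriv X p) (phi_alg (ltriv Y p)) = - curv_form (phi_alg (ltriv X p)) (ltriv Y p)"
    using curv_form_phi_alg[OF ltriv_u_alg[OF X p] ltriv_u_alg[OF Y p]] by simp
  have "ltriv (nabla W ?K) p - ltriv (curvature nabla (nabla W X) Y Z) p
      - ltriv (curvature nabla X (nabla W Y) Z) p - ltriv (curvature nabla X Y (nabla W Z)) p = 0"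
    by (simp add: ltriv_nabla[OF W K p] dK ltriv_curvature[OF X Y Z p]
        ltriv_curvature[OF vector_field_nabla[OF W X] Y Z p] ltriv_curvature[OF X vector_field_nabla[OF W Y] Z p]
        ltriv_curvature[OF X Y vector_field_nabla[OF W Z] p]
        ltriv_nabla[OF W X p] ltriv_nabla[OF W Y p] ltriv_nabla[OF W Z p]
        curv_form_linear_simps phi_alg_linear_simps inv algebra_simps)
  then have "p ** (ltriv (nabla W ?K) p - ltriv (curvature nabla (nabla W X) Y Z) p
      - ltriv (curvature nabla X (nabla W Y) Z) p - ltriv (curvature nabla X Y (nabla W Z)) p) = p ** 0"
    by (rule arg_cong)
  then show "nabla W ?K p - curvature nabla (nabla W X) Y Z p - curvature nabla X (nabla W Y) Z p
      - curvature nabla X Y (nabla W Z) p = 0"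
    by (simp add: matrix_mult_linear_simps ltriv_inverse[OF p])
qed

end

section \<open>Parallel transport\<close>

lemma phi_alg_cube: "phi_alg (phi_alg (phi_alg A)) = - phi_alg A"
  by (simp add: phi_alg_def ip_e_def)

lemma phi_alg_skew: "ip_e A (phi_alg A) = 0"
  by (simp add: phi_alg_def ip_e_def)

lemma phi_alg_orthogonal_xi: "ip_e xi1 (phi_alg A) = 0" "ip_e xi2 (phi_alg A) = 0"
  by (simp_all add: phi_alg_def ip_e_def)

lemma sum_frame: "(\<Sum>E\<in>frame. f E) = f X12 + f Y12 + f xi1 + (f xi2 :: 'a::comm_monoid_add)"
  using frame_distinct by (simp add: frame_def add.assoc)

lemma has_vector_derivative_u_alg:
  assumes v: "(v has_vector_derivative v') (at t)" and T: "open T" "t \<in> T" "\<And>s. s \<in> T \<Longrightarrow> v s \<in> u_alg"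
  shows "v' \<in> u_alg"
proof -
  have "((\<lambda>s. herm_adj (v s) + v s) has_vector_derivative herm_adj v' + v') (at t)"
    using v by (intro has_vector_derivative_add bounded_linear.has_vector_derivative[OF bounded_linear_herm_adj])
  moreover have "((\<lambda>s. herm_adj (v s) + v s) has_vector_derivative 0) (at t)"
    by (rule has_vector_derivative_transform_within_open[OF has_vector_derivative_const T(1,2)])
      (use T(3) in \<open>simp add: u_alg_def\<close>)
  ultimately have "herm_adj v' + v' = 0" by (rule vector_derivative_unique_at)
  then show ?thesis by (simp add: u_alg_def eq_neg_iff_add_eq_0)
qed

lemma has_vector_derivative_U2:
  assumes g: "(\<gamma> has_vector_derivative \<gamma>') (at t)" and T: "open T" "t \<in> T" "\<And>s. s \<in> T \<Longrightarrow> \<gamma> s \<in> U2"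
  shows "herm_adj (\<gamma> t) ** \<gamma>' \<in> u_alg"
proof -
  have "((\<lambda>s. herm_adj (\<gamma> s) ** \<gamma> s) has_vector_derivative
      herm_adj (\<gamma> t) ** \<gamma>' + herm_adj \<gamma>' ** \<gamma> t) (at t)"
    using g by (intro bounded_bilinear.has_vector_derivative[OF bounded_bilinear_matrix_mult]
        bounded_linear.has_vector_derivative[OF bounded_linear_herm_adj])
  moreover have "((\<lambda>s. herm_adj (\<gamma> s) ** \<gamma> s) has_vector_derivative 0) (at t)"
    by (rule has_vector_derivative_transform_within_open[OF has_vector_derivative_const T(1,2)])
      (use T(3) in \<open>simp add: U2_inverse\<close>)
  ultimately have "herm_adj (\<gamma> t) ** \<gamma>' + herm_adj \<gamma>' ** \<gamma> t = 0" by (rule vector_derivative_unique_at)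
  then show ?thesis
    by (simp add: u_alg_def herm_adj_mult eq_neg_iff_add_eq_0 add.commute)
qed

lemma piecewise_smooth_continuous:
  assumes "piecewise_smooth \<gamma>"
  shows "continuous_on {0..1} \<gamma>"
proof -
  obtain n :: nat and s where s: "s 0 = 0" "s n = 1" and
    piece: "\<And>i. i < n \<Longrightarrow> s i < s (Suc i) \<and>
        (\<exists>S h. open S \<and> {s i..s (Suc i)} \<subseteq> S \<and> (\<forall>k. Ck_on k S h) \<and>
           (\<forall>t\<in>{s i..s (Suc i)}. \<gamma> t = h t))"
    using assms unfolding piecewise_smooth_def by blast
  have "m \<le> n \<Longrightarrow> s 0 \<le> s m \<and> continuous_on {s 0..s m} \<gamma>" for m
  proof (induction m)
    case (Suc m)
    then have IH: "s 0 \<le> s m" "continuous_on {s 0..s m} \<gamma>" and lt: "s m < s (Suc m)"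
      using piece[of m] by auto
    obtain S h where h: "{s m..s (Suc m)} \<subseteq> S" "Ck_on 0 S h" "\<forall>t\<in>{s m..s (Suc m)}. \<gamma> t = h t"
      using piece[of m] Suc.prems by (metis Suc_le_lessD)
    then have "continuous_on {s m..s (Suc m)} h" by (simp add: continuous_on_subset)
    then have "continuous_on {s m..s (Suc m)} \<gamma>"
      by (rule continuous_on_eq) (use h(3) in simp)
    then have "continuous_on ({s 0..s m} \<union> {s m..s (Suc m)}) \<gamma>"
      using IH by (intro continuous_on_closed_Un) auto
    moreover have "{s 0..s m} \<union> {s m..s (Suc m)} = {s 0..s (Suc m)}" using IH lt by auto
    ultimately show ?case using IH lt by auto
  qed simp
  then show ?thesis using s by (metis order_refl)
qed

context skew_torsion_connection
begin

text \<open>In the trivialisation, parallel transport is a linear ordinary differential equation whose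
coefficient is a scalar multiple of the fixed endomorphism \<open>phi_alg\<close>.\<close>

lemma cov_deriv_ltriv:
  assumes T: "open T" "t \<in> T" "\<And>s. s \<in> T \<Longrightarrow> \<gamma> s \<in> U2"
    and g: "(\<gamma> has_vector_derivative \<gamma>') (at t)"
    and v: "(v has_vector_derivative v') (at t)" "\<And>s. s \<in> T \<Longrightarrow> v s \<in> u_alg"
    and V: "\<And>s. s \<in> T \<Longrightarrow> V s = \<gamma> s ** v s"
  shows "cov_deriv nabla \<gamma> V t
    = \<gamma> t ** (v' + conn_form (herm_adj (\<gamma> t) ** \<gamma>') *\<^sub>R phi_alg (v t))"
proof -
  let ?B = "herm_adj (\<gamma> t) ** \<gamma>'"
  have p: "\<gamma> t \<in> U2" using T by blast
  have B: "?B \<in> u_alg" using has_vector_derivative_U2[OF g T] .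
  have v': "v' \<in> u_alg" using has_vector_derivative_u_alg[OF v(1) T(1,2) v(2)] .
  have coord: "lmetric (\<gamma> s) (linv E (\<gamma> s)) (V s) = ip_e E (v s)" if "s \<in> T" for s E
    using lmetric_linv[OF T(3)[OF that], of E "v s"] V[OF that] by (simp add: linv_def)
  have "((\<lambda>s. ip_e E (v s)) has_vector_derivative ip_e E v') (at t)" for E
    using bounded_linear.has_vector_derivative[OF
        bounded_bilinear.bounded_linear_right[OF bounded_bilinear_ip_e] v(1)] .
  then have "((\<lambda>s. lmetric (\<gamma> s) (linv E (\<gamma> s)) (V s)) has_vector_derivative ip_e E v') (at t)" for E
    by (rule has_vector_derivative_transform_within_open[OF _ T(1,2)]) (simp add: coord)
  then have d: "vector_derivative (\<lambda>s. lmetric (\<gamma> s) (linv E (\<gamma> s)) (V s)) (at t) = ip_e E v'" for E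
    by (rule vector_derivative_at)
  have E: "nabla (linv ?B) (linv E) (\<gamma> t) = \<gamma> t ** (conn_form ?B *\<^sub>R phi_alg E)" if "E \<in> frame" for E
    using nabla_linv[OF B _ p, of E] that frame_u_alg by (auto simp: frame_def linv_def)
  have "cov_deriv nabla \<gamma> V t = (\<Sum>E\<in>frame. \<gamma> t ** (ip_e E v' *\<^sub>R E + (conn_form ?B * ip_e E (v t)) *\<^sub>R phi_alg E))"
    unfolding cov_deriv_def vector_derivative_at[OF g] d coord[OF T(2)]
    by (rule sum.cong) (simp_all add: E linv_def matrix_mult_linear_simps mult.commute)
  also have "\<dots> = \<gamma> t ** ((ip_e X12 v' *\<^sub>R X12 + ip_e Y12 v' *\<^sub>R Y12 + ip_e xi1 v' *\<^sub>R xi1 + ip_e xi2 v' *\<^sub>R xi2)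
      + conn_form ?B *\<^sub>R phi_alg (ip_e X12 (v t) *\<^sub>R X12 + ip_e Y12 (v t) *\<^sub>R Y12
          + ip_e xi1 (v t) *\<^sub>R xi1 + ip_e xi2 (v t) *\<^sub>R xi2))"
    by (simp add: sum_frame matrix_mult_linear_simps phi_alg_linear_simps scaleR_add_right)
  finally show ?thesis
    by (simp only: u_alg_expansion[OF v', symmetric] u_alg_expansion[OF v(2)[OF T(2)], symmetric])
qed

text \<open>The derivative of \<open>v\<close> is a multiple of \<open>phi_alg v\<close> off a finite set, which is orthogonal to \<open>v\<close>,
\<open>xi1\<close> and \<open>xi2\<close>; the continuous functions in question therefore have zero derivative off a finite set.\<close>

lemma parallel_transport_invariants:
  assumes loop: "loop_at p \<gamma>" and par: "parallel_along nabla \<gamma> V"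
  defines "v \<equiv> \<lambda>s. herm_adj (\<gamma> s) ** V s"
  shows "ip_e (v 1) (v 1) = ip_e (v 0) (v 0)" "ip_e xi1 (v 1) = ip_e xi1 (v 0)"
    "ip_e xi2 (v 1) = ip_e xi2 (v 0)"
proof -
  have U: "\<gamma> s \<in> U2" if "s \<in> {0..1}" for s using loop that by (simp add: loop_at_def)
  have cg: "continuous_on {0..1} \<gamma>" using loop by (simp add: loop_at_def piecewise_smooth_continuous)
  have cV: "continuous_on {0..1} V" and tV: "\<And>t. t \<in> {0..1} \<Longrightarrow> V t \<in> tangent (\<gamma> t)"
    using par by (auto simp: parallel_along_def)
  obtain K where K: "finite K" and par': "\<And>t. t \<in> {0..1} - K \<Longrightarrow>
      \<gamma> differentiable (at t) \<and> V differentiable (at t) \<and> cov_deriv nabla \<gamma> V t = 0"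
    using par unfolding parallel_along_def by blast
  have cv: "continuous_on {0..1} v"
    unfolding v_def
    by (intro bounded_bilinear.continuous_on[OF bounded_bilinear_matrix_mult]
        bounded_linear.continuous_on[OF bounded_linear_herm_adj] cg cV)
  have ode: "\<exists>c. (v has_vector_derivative c *\<^sub>R phi_alg (v t)) (at t)" if t: "t \<in> {0..1} - (K \<union> {0, 1})" for t
  proof -
    have T: "open {0<..<1::real}" "t \<in> {0<..<1}" "\<And>s. s \<in> {0<..<1} \<Longrightarrow> \<gamma> s \<in> U2"
      using t U by auto
    obtain \<gamma>' V' where g: "(\<gamma> has_vector_derivative \<gamma>') (at t)" and V: "(V has_vector_derivative V') (at t)"
      using par'[of t] t vector_derivative_works by blast
    define v' where "v' = herm_adj (\<gamma> t) ** V' + herm_adj \<gamma>' ** V t"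
    have v: "(v has_vector_derivative v') (at t)"
      unfolding v_def v'_def
      by (intro bounded_bilinear.has_vector_derivative[OF bounded_bilinear_matrix_mult]
          bounded_linear.has_vector_derivative[OF bounded_linear_herm_adj] g V)
    have "cov_deriv nabla \<gamma> V t = \<gamma> t ** (v' + conn_form (herm_adj (\<gamma> t) ** \<gamma>') *\<^sub>R phi_alg (v t))"
    proof (rule cov_deriv_ltriv[OF T g v])
      show "v s \<in> u_alg" "V s = \<gamma> s ** v s" if "s \<in> {0<..<1}" for s
        using that U[of s] tV[of s] by (simp_all add: v_def tangent_iff[symmetric] U2_cancel)
    qed
    then have "\<gamma> t ** (v' + conn_form (herm_adj (\<gamma> t) ** \<gamma>') *\<^sub>R phi_alg (v t)) = 0"
      using par'[of t] t by simp
    then have "v' + conn_form (herm_adj (\<gamma> t) ** \<gamma>') *\<^sub>R phi_alg (v t) = 0"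
      using U2_cancel(1)[OF T(3)[OF T(2)]] by (metis matrix_mult_zero_right)
    then have "v' = (- conn_form (herm_adj (\<gamma> t) ** \<gamma>')) *\<^sub>R phi_alg (v t)"
      by (simp add: add_eq_0_iff2)
    with v show ?thesis by blast
  qed
  have const: "f 1 = f 0"
    if f: "continuous_on {0..1} f" "\<And>t. t \<in> {0..1} - (K \<union> {0, 1}) \<Longrightarrow> (f has_vector_derivative 0) (at t)"
    for f :: "real \<Rightarrow> real"
  proof (rule has_derivative_zero_unique_strong_interval[where f=f and k="K \<union> {0, 1}" and a=0 and b=1])
    show "(f has_derivative (\<lambda>h. 0)) (at x within {0..1})" if "x \<in> {0..1} - (K \<union> {0, 1})" for x
      using f(2)[OF that] by (simp add: has_vector_derivative_def has_derivative_at_withinI)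
  qed (use K f in auto)
  show "ip_e (v 1) (v 1) = ip_e (v 0) (v 0)"
  proof (rule const)
    show "continuous_on {0..1} (\<lambda>t. ip_e (v t) (v t))"
      by (intro bounded_bilinear.continuous_on[OF bounded_bilinear_ip_e] cv)
    fix t assume "t \<in> {0..1} - (K \<union> {0, 1})"
    then obtain c where "(v has_vector_derivative c *\<^sub>R phi_alg (v t)) (at t)" using ode by blast
    from bounded_bilinear.has_vector_derivative[OF bounded_bilinear_ip_e this this]
    show "((\<lambda>t. ip_e (v t) (v t)) has_vector_derivative 0) (at t)"
      by (simp add: ip_e_linear_simps phi_alg_skew ip_e_commute[of "phi_alg _"])
  qed
  have xi: "ip_e \<xi> (v 1) = ip_e \<xi> (v 0)" if \<xi>: "\<And>A. ip_e \<xi> (phi_alg A) = 0" for \<xi>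
  proof (rule const)
    show "continuous_on {0..1} (\<lambda>t. ip_e \<xi> (v t))"
      by (intro bounded_bilinear.continuous_on[OF bounded_bilinear_ip_e] cv continuous_on_const)
    fix t assume "t \<in> {0..1} - (K \<union> {0, 1})"
    then obtain c where "(v has_vector_derivative c *\<^sub>R phi_alg (v t)) (at t)" using ode by blast
    from bounded_linear.has_vector_derivative[OF
        bounded_bilinear.bounded_linear_right[OF bounded_bilinear_ip_e, of \<xi>] this]
    show "((\<lambda>t. ip_e \<xi> (v t)) has_vector_derivative 0) (at t)"
      by (simp add: ip_e_linear_simps \<xi>)
  qed
  show "ip_e xi1 (v 1) = ip_e xi1 (v 0)" "ip_e xi2 (v 1) = ip_e xi2 (v 0)"
    using xi phi_alg_orthogonal_xi by blast+
qed

end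

text \<open>The exponential \<open>exp(a \<phi>)\<close>, in closed form because \<open>\<phi>\<^sup>3 = - \<phi>\<close>.\<close>

definition phi_rot :: "real \<Rightarrow> mat2 \<Rightarrow> mat2" where
  "phi_rot a w = w + sin a *\<^sub>R phi_alg w + (1 - cos a) *\<^sub>R phi_alg (phi_alg w)"

lemma phi_rot_u_alg: "w \<in> u_alg \<Longrightarrow> phi_rot a w \<in> u_alg"
  by (simp add: phi_rot_def u_alg_closed phi_alg_u_alg)

lemma phi_rot_has_vector_derivative:
  "((\<lambda>t. phi_rot (c * t) w) has_vector_derivative c *\<^sub>R phi_alg (phi_rot (c * t) w)) (at t)"
proof -
  have "((\<lambda>t. phi_rot (c * t) w) has_vector_derivative
      (c * cos (c * t)) *\<^sub>R phi_alg w + (c * sin (c * t)) *\<^sub>R phi_alg (phi_alg w)) (at t)"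
    unfolding phi_rot_def has_vector_derivative_def
    by (auto intro!: derivative_eq_intros simp: algebra_simps)
  moreover have "phi_alg (phi_rot (c * t) w) = cos (c * t) *\<^sub>R phi_alg w + sin (c * t) *\<^sub>R phi_alg (phi_alg w)"
    by (simp add: phi_rot_def phi_alg_linear_simps phi_alg_cube algebra_simps)
  ultimately show ?thesis by (simp add: scaleR_add_right)
qed

text \<open>Factorials times the coefficients of sine and cosine encode the four-periodic pattern of the powers; the extra
summand for \<open>n = 0\<close> is the component of \<open>w\<close> in the kernel.\<close>

lemma phi_alg_power:
  "(phi_alg ^^ n) w = (if n = 0 then w + phi_alg (phi_alg w) else 0)
    + (fact n * sin_coeff n) *\<^sub>R phi_alg w - (fact n * cos_coeff n) *\<^sub>R phi_alg (phi_alg w)"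
proof (induction n)
  case 0
  then show ?case by simp
next
  case (Suc n)
  have "phi_alg 0 = 0" by (simp add: phi_alg_def ip_e_def)
  then show ?case
    by (simp add: Suc phi_alg_linear_simps phi_alg_cube sin_coeff_Suc cos_coeff_Suc field_simps
        del: of_nat_Suc)
qed

lemma phi_alg_exp_sums: "(\<lambda>n. (x ^ n / fact n) *\<^sub>R (phi_alg ^^ n) w) sums phi_rot x w"
proof -
  have "(\<lambda>n. (if n = 0 then w + phi_alg (phi_alg w) else 0) + (sin_coeff n *\<^sub>R x ^ n) *\<^sub>R phi_alg w
      - (cos_coeff n *\<^sub>R x ^ n) *\<^sub>R phi_alg (phi_alg w))
    sums (w + phi_alg (phi_alg w) + sin x *\<^sub>R phi_alg w - cos x *\<^sub>R phi_alg (phi_alg w))"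
    by (intro sums_add sums_diff sums_scaleR_left sin_converges cos_converges sums_single)
  moreover have "(\<lambda>n. (if n = 0 then w + phi_alg (phi_alg w) else 0) + (sin_coeff n *\<^sub>R x ^ n) *\<^sub>R phi_alg w
      - (cos_coeff n *\<^sub>R x ^ n) *\<^sub>R phi_alg (phi_alg w)) = (\<lambda>n. (x ^ n / fact n) *\<^sub>R (phi_alg ^^ n) w)"
    by (rule ext) (simp add: phi_alg_power algebra_simps)
  moreover have "w + phi_alg (phi_alg w) + sin x *\<^sub>R phi_alg w - cos x *\<^sub>R phi_alg (phi_alg w) = phi_rot x w"
    by (simp add: phi_rot_def algebra_simps)
  ultimately show ?thesis by (simp only:)
qed

lemma Ck_on_trig: "Ck_on k UNIV (\<lambda>t::real. cos (a * t) *\<^sub>R u + sin (a * t) *\<^sub>R (w::'a::real_normed_vector))"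
proof (induction k arbitrary: u w)
  case 0
  then show ?case by (auto intro!: continuous_intros)
next
  case (Suc k)
  show ?case
  proof (rule Ck_on_Suc_intro[OF open_UNIV])
    show "((\<lambda>t. cos (a * t) *\<^sub>R u + sin (a * t) *\<^sub>R w) has_derivative
        (\<lambda>v. cos (a * t) *\<^sub>R ((v * a) *\<^sub>R w) + sin (a * t) *\<^sub>R (- (v * a) *\<^sub>R u))) (at t)" for t
      by (auto intro!: derivative_eq_intros simp: algebra_simps)
    show "Ck_on k UNIV (\<lambda>t. cos (a * t) *\<^sub>R ((v * a) *\<^sub>R w) + sin (a * t) *\<^sub>R (- (v * a) *\<^sub>R u))" for v
      by (rule Suc)
  qed
qed

context skew_torsion_connection
begin

text \<open>Along a one-parameter group with generator \<open>2 \<pi> N\<close> the transport equation has the constant coefficient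
\<open>- 2 \<pi> conn_form N\<close>. The group closes up after time 1 for every unit \<open>N\<close> in su(2), while \<open>conn_form N\<close>
varies with the axis, so tilting the axis realises any rotation angle.\<close>

lemma rotation_in_holonomy_group:
  assumes p: "p \<in> U2" and h: "\<And>w. w \<in> u_alg \<Longrightarrow> h (p ** w) = p ** phi_rot a w"
  shows "h \<in> holonomy_group nabla p"
proof -
  \<comment> \<open>Only the angle modulo \<open>2 \<pi>\<close> matters; bounding it makes the slope \<open>k\<close> of the axis at most 1.\<close>
  obtain t where t: "0 \<le> t" "t < 2 * pi" "cos a = cos t" "sin a = sin t"
    using sincos_total_2pi[of "cos a" "sin a"] by (metis sin_cos_squared_add2)
  define k where "k = t / (4 * pi)"
  have k: "0 \<le> k" "k \<le> 1" using t by (simp_all add: k_def field_simps)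
  have "k * k \<le> 1" using k by (simp add: mult_le_one)
  then have "sqrt (1 - k * k) * sqrt (1 - k * k) = 1 - k * k" by simp
  then obtain r where r: "r * r = 1 - k * k" by blast
  \<comment> \<open>Here \<open>xi1 + xi2\<close> and \<open>Y12\<close> are anticommuting square roots of \<open>- 1\<close>, so that \<open>N\<^sup>2 = - 1\<close>.\<close>
  define N where "N = k *\<^sub>R (xi1 + xi2) + r *\<^sub>R Y12"
  have Nu: "N \<in> u_alg" by (simp add: N_def u_alg_closed frame_u_alg)
  have NN: "N ** N = - mat 1"
    by (simp add: N_def mat2_eq_iff matrix_matrix_mult_def sum_2 mat_def complex_eq_iff r algebra_simps)
  have N3: "N ** (N ** N) = - N" by (simp add: NN matrix_mult_linear_simps)
  have form: "conn_form ((2 * pi) *\<^sub>R N) = - t"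
    by (simp add: N_def conn_form_def ip_e_def k_def)
  define \<gamma> where "\<gamma> = (\<lambda>s. cos (2 * pi * s) *\<^sub>R p + sin (2 * pi * s) *\<^sub>R (p ** N))"
  have U: "\<gamma> s \<in> U2" for s
  proof -
    have "\<gamma> s = p ** (mat 1 + sin (2 * pi * s) *\<^sub>R N + (1 - cos (2 * pi * s)) *\<^sub>R (N ** N))"
      by (simp add: \<gamma>_def NN matrix_mult_linear_simps algebra_simps)
    then show ?thesis using unitary_one_parameter_group[OF Nu N3 p] by simp
  qed
  have g: "(\<gamma> has_vector_derivative \<gamma> s ** ((2 * pi) *\<^sub>R N)) (at s)" for s
  proof -
    have "(\<gamma> has_vector_derivative (2 * pi * cos (2 * pi * s)) *\<^sub>R (p ** N) - (2 * pi * sin (2 * pi * s)) *\<^sub>R p) (at s)"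
      unfolding \<gamma>_def has_vector_derivative_def
      by (auto intro!: derivative_eq_intros simp: algebra_simps)
    moreover have "\<gamma> s ** ((2 * pi) *\<^sub>R N)
        = (2 * pi * cos (2 * pi * s)) *\<^sub>R (p ** N) - (2 * pi * sin (2 * pi * s)) *\<^sub>R p"
      by (simp add: \<gamma>_def matrix_mult_linear_simps matrix_mul_assoc[symmetric] NN algebra_simps)
    ultimately show ?thesis by simp
  qed
  have ends: "\<gamma> 0 = p" "\<gamma> 1 = p" by (simp_all add: \<gamma>_def)
  have "piecewise_smooth \<gamma>"
    unfolding piecewise_smooth_def
    by (rule exI[of _ 1], rule exI[of _ real]) (auto intro!: exI[of _ UNIV] exI[of _ \<gamma>] simp: \<gamma>_def Ck_on_trig)
  then have loop: "loop_at p \<gamma>" using U ends by (simp add: loop_at_def)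
  have "\<exists>V. parallel_along nabla \<gamma> V \<and> V 0 = v \<and> V 1 = h v" if v: "v \<in> tangent p" for v
  proof -
    obtain w where w: "w \<in> u_alg" "v = p ** w" using v by (rule tangentE)
    define V where "V s = \<gamma> s ** phi_rot (t * s) w" for s
    note r = phi_rot_has_vector_derivative[of t w]
    have V: "(V has_vector_derivative
        \<gamma> s ** (t *\<^sub>R phi_alg (phi_rot (t * s) w)) + \<gamma> s ** ((2 * pi) *\<^sub>R N) ** phi_rot (t * s) w) (at s)" for s
      unfolding V_def by (rule bounded_bilinear.has_vector_derivative[OF bounded_bilinear_matrix_mult g r])
    have "cov_deriv nabla \<gamma> V s = 0" for s
    proof -
      have "cov_deriv nabla \<gamma> V s = \<gamma> s ** (t *\<^sub>R phi_alg (phi_rot (t * s) w)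
          + conn_form (herm_adj (\<gamma> s) ** (\<gamma> s ** ((2 * pi) *\<^sub>R N))) *\<^sub>R phi_alg (phi_rot (t * s) w))"
        by (rule cov_deriv_ltriv[OF open_UNIV UNIV_I U g r phi_rot_u_alg[OF w(1)]]) (simp add: V_def)
      then show ?thesis by (simp only: U2_cancel[OF U] form) (simp add: matrix_mult_zero_right)
    qed
    moreover have "continuous_on {0..1} V"
      using V by (auto intro!: continuous_at_imp_continuous_on has_vector_derivative_continuous)
    moreover have "V s \<in> tangent (\<gamma> s)" for s
      unfolding V_def using w(1) by (intro tangent_linv phi_rot_u_alg)
    moreover have "\<gamma> differentiable (at s)" "V differentiable (at s)" for s
      using g[of s] V[of s] by (auto simp: differentiable_def has_vector_derivative_def)
    ultimately have "parallel_along nabla \<gamma> V"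
      unfolding parallel_along_def by (auto intro!: exI[of _ "{}"])
    moreover have "V 0 = v" "V 1 = h v"
      using t(3,4) h[OF w(1)] by (simp_all add: V_def ends w(2) phi_rot_def)
    ultimately show ?thesis by blast
  qed
  with loop show ?thesis unfolding holonomy_group_def by blast
qed

end

section \<open>The holonomy algebra\<close>

text \<open>The endomorphism \<open>phi p\<close> in the normal form of \<open>endo p\<close>, zero off the tangent space.\<close>

definition phi_endo :: "mat2 \<Rightarrow> mat2 \<Rightarrow> mat2" where
  "phi_endo p v = (if v \<in> tangent p then p ** phi_alg (herm_adj p ** v) else 0)"

lemma phi_endo_linv: "p \<in> U2 \<Longrightarrow> w \<in> u_alg \<Longrightarrow> phi_endo p (p ** w) = p ** phi_alg w"
  by (simp add: phi_endo_def tangent_linv U2_cancel)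

lemma endo_power:
  assumes A: "A \<in> endo p" and v: "v \<in> tangent p"
  shows "((\<lambda>v. t *\<^sub>R A v) ^^ n) v = t ^ n *\<^sub>R (A ^^ n) v" "(A ^^ n) v \<in> tangent p"
proof (induction n)
  case (Suc n)
  {
    case 1
    then show ?case using Suc A by (simp add: endo_def)
  next
    case 2
    then show ?case using Suc A by (simp add: endo_def)
  }
qed (use v in simp_all)

text \<open>An element of \<open>endo p\<close> is linear on the tangent space only; expanding in the frame extends its restriction to
a linear map on all matrices, which is bounded by finite dimension.\<close>

lemma endo_bounded:
  assumes p: "p \<in> U2" and A: "A \<in> endo p"
  obtains K where "K > 0" "\<And>v. v \<in> tangent p \<Longrightarrow> norm (A v) \<le> norm v * K"
proof -
  let ?f = "\<lambda>E v. ip_e E (herm_adj p ** v)"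
  define L where "L v = ?f X12 v *\<^sub>R A (p ** X12) + ?f Y12 v *\<^sub>R A (p ** Y12)
    + ?f xi1 v *\<^sub>R A (p ** xi1) + ?f xi2 v *\<^sub>R A (p ** xi2)" for v
  have "linear L"
    by (rule linearI) (simp_all add: L_def matrix_mult_linear_simps ip_e_linear_simps algebra_simps)
  then have "bounded_linear L" by (simp add: linear_conv_bounded_linear)
  then obtain K where K: "K > 0" "\<And>v. norm (L v) \<le> norm v * K"
    using bounded_linear.pos_bounded by blast
  have add: "A (v + w) = A v + A w" if "v \<in> tangent p" "w \<in> tangent p" for v w
    using A that by (simp add: endo_def)
  have scale: "A (c *\<^sub>R v) = c *\<^sub>R A v" if "v \<in> tangent p" for c v
    using A that by (simp add: endo_def)
  have "L v = A v" if v: "v \<in> tangent p" for v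
  proof -
    obtain w where w: "w \<in> u_alg" "v = p ** w" using v by (rule tangentE)
    have t: "p ** X12 \<in> tangent p" "p ** Y12 \<in> tangent p" "p ** xi1 \<in> tangent p" "p ** xi2 \<in> tangent p"
      by (simp_all add: tangent_linv frame_u_alg)
    have "v = ip_e X12 w *\<^sub>R (p ** X12) + ip_e Y12 w *\<^sub>R (p ** Y12)
        + ip_e xi1 w *\<^sub>R (p ** xi1) + ip_e xi2 w *\<^sub>R (p ** xi2)"
      unfolding w(2) by (subst u_alg_expansion[OF w(1)]) (simp add: matrix_mult_linear_simps)
    then have "A v = ip_e X12 w *\<^sub>R A (p ** X12) + ip_e Y12 w *\<^sub>R A (p ** Y12)
        + ip_e xi1 w *\<^sub>R A (p ** xi1) + ip_e xi2 w *\<^sub>R A (p ** xi2)"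
      by (simp add: add scale t tangent_closed)
    then show ?thesis by (simp add: L_def w(2) U2_cancel[OF p])
  qed
  then show thesis using that[OF K(1)] K(2) by metis
qed

lemma endo_exp_sums:
  assumes p: "p \<in> U2" and A: "A \<in> endo p" and v: "v \<in> tangent p"
  shows "(\<lambda>n. (t ^ n / fact n) *\<^sub>R (A ^^ n) v) sums endo_exp (\<lambda>v. t *\<^sub>R A v) v"
proof -
  obtain K where K: "K > 0" "\<And>v. v \<in> tangent p \<Longrightarrow> norm (A v) \<le> norm v * K"
    using endo_bounded[OF p A] by blast
  have bound: "norm ((A ^^ n) v) \<le> K ^ n * norm v" for n
  proof (induction n)
    case (Suc n)
    have "norm ((A ^^ Suc n) v) \<le> norm ((A ^^ n) v) * K" using K(2) endo_power(2)[OF A v] by simp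
    also have "\<dots> \<le> K ^ n * norm v * K" using Suc K(1) by (intro mult_right_mono) auto
    finally show ?case by (simp add: algebra_simps)
  qed simp
  have "summable (\<lambda>n. (t ^ n / fact n) *\<^sub>R (A ^^ n) v)"
  proof (rule summable_comparison_test')
    show "summable (\<lambda>n. inverse (fact n) * (\<bar>t\<bar> * K) ^ n * norm v)"
      by (intro summable_mult2 summable_exp)
    show "norm ((t ^ n / fact n) *\<^sub>R (A ^^ n) v) \<le> inverse (fact n) * (\<bar>t\<bar> * K) ^ n * norm v" for n
      using mult_left_mono[OF bound[of n], of "\<bar>t\<bar> ^ n / fact n"]
      by (simp add: power_abs power_mult_distrib field_simps)
  qed
  moreover have "endo_exp (\<lambda>v. t *\<^sub>R A v) v = (\<Sum>n. (t ^ n / fact n) *\<^sub>R (A ^^ n) v)"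
    unfolding endo_exp_def by (simp add: endo_power(1)[OF A v] divide_inverse mult.commute)
  ultimately show ?thesis by (simp add: summable_sums)
qed

lemma endo_exp_zero:
  assumes "p \<in> U2" "A \<in> endo p" "v \<in> tangent p"
  shows "endo_exp (\<lambda>v. 0 *\<^sub>R A v) v = v"
proof -
  have "(\<lambda>n. (0 ^ n / fact n) *\<^sub>R (A ^^ n) v) = (\<lambda>n. if n = 0 then v else 0)" by auto
  then have "(\<lambda>n. (0 ^ n / fact n) *\<^sub>R (A ^^ n) v) sums v" using sums_single[of 0 "\<lambda>_. v"] by simp
  then show ?thesis using endo_exp_sums[OF assms, of 0] sums_unique2 by blast
qed

lemma endo_exp_has_vector_derivative:
  assumes p: "p \<in> U2" and A: "A \<in> endo p" and v: "v \<in> tangent p"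
  shows "((\<lambda>t. endo_exp (\<lambda>v. t *\<^sub>R A v) v) has_vector_derivative A v) (at 0)"
  unfolding has_vector_derivative_def
proof (subst has_derivative_componentwise_within, rule ballI)
  fix b :: mat2 assume "b \<in> Basis"
  let ?c = "\<lambda>n. ((A ^^ n) v \<bullet> b) / fact n"
  have s: "(\<lambda>n. ?c n * t ^ n) sums (endo_exp (\<lambda>v. t *\<^sub>R A v) v \<bullet> b)" for t
    using bounded_linear.sums[OF bounded_linear_inner_left endo_exp_sums[OF p A v, of t], of b]
    by (simp add: mult.commute)
  have "((\<lambda>t. \<Sum>n. ?c n * t ^ n) has_real_derivative (\<Sum>n. diffs ?c n * 0 ^ n)) (at 0)"
    using s by (intro termdiffs_strong_converges_everywhere) (auto simp: sums_iff)
  moreover have "(\<Sum>n. diffs ?c n * 0 ^ n) = A v \<bullet> b"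
    unfolding powser_zero by (simp add: diffs_def)
  moreover have "(\<lambda>t. \<Sum>n. ?c n * t ^ n) = (\<lambda>t. endo_exp (\<lambda>v. t *\<^sub>R A v) v \<bullet> b)"
    using s by (auto simp: sums_iff)
  ultimately have "((\<lambda>t. endo_exp (\<lambda>v. t *\<^sub>R A v) v \<bullet> b) has_real_derivative A v \<bullet> b) (at 0)" by simp
  then show "((\<lambda>t. endo_exp (\<lambda>v. t *\<^sub>R A v) v \<bullet> b) has_derivative (\<lambda>t. (t *\<^sub>R A v) \<bullet> b)) (at 0)"
    unfolding has_field_derivative_def by (rule has_derivative_eq_rhs) (simp add: fun_eq_iff mult.commute)
qed

text \<open>A skew map with image orthogonal to \<open>xi1\<close> and \<open>xi2\<close> also kills these, so it is a skew map of the plane of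
\<open>X12\<close> and \<open>Y12\<close>, and such maps form a line.\<close>

lemma skew_vertical_eq_phi_alg:
  assumes a: "\<And>w. w \<in> u_alg \<Longrightarrow> a w \<in> u_alg"
    and add: "\<And>v w. v \<in> u_alg \<Longrightarrow> w \<in> u_alg \<Longrightarrow> a (v + w) = a v + a w"
    and skew: "\<And>w. w \<in> u_alg \<Longrightarrow> ip_e w (a w) = 0"
    and vert: "\<And>w. w \<in> u_alg \<Longrightarrow> ip_e xi1 (a w) = 0" "\<And>w. w \<in> u_alg \<Longrightarrow> ip_e xi2 (a w) = 0"
  obtains c where "\<And>w. w \<in> u_alg \<Longrightarrow> a w = c *\<^sub>R phi_alg w"
proof -
  define c where "c = ip_e Y12 (a X12)"
  note fr = frame_u_alg
  have pol: "ip_e v (a w) = - ip_e w (a v)" if "v \<in> u_alg" "w \<in> u_alg" for v w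
    using skew[OF u_alg_closed(2)[OF that]] skew[OF that(1)] skew[OF that(2)]
    by (simp add: add[OF that] ip_e_linear_simps)
  have "a X12 = c *\<^sub>R Y12"
    by (subst u_alg_expansion[OF a[OF fr(1)]]) (simp add: skew vert fr c_def)
  moreover have "a Y12 = - c *\<^sub>R X12"
    by (subst u_alg_expansion[OF a[OF fr(2)]]) (simp add: skew vert fr c_def pol[OF fr(1,2)])
  ultimately have *: "ip_e X12 (a w) = - c * ip_e Y12 w" "ip_e Y12 (a w) = c * ip_e X12 w"
    if "w \<in> u_alg" for w
    using pol[OF fr(1) that] pol[OF fr(2) that] 
    by (simp_all add: ip_e_linear_simps bounded_bilinear.minus_left[OF bounded_bilinear_ip_e]
        ip_e_commute[of w])
  have "a w = c *\<^sub>R phi_alg w" if w: "w \<in> u_alg" for w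
    by (subst u_alg_expansion[OF a[OF w]]) (simp add: vert w * phi_alg_def algebra_simps)
  then show thesis by (rule that)
qed

lemma phi_endo_endo:
  assumes p: "p \<in> U2"
  shows "(\<lambda>v. c *\<^sub>R phi_endo p v) \<in> endo p"
  unfolding endo_def
proof (intro CollectI conjI ballI allI impI)
  fix v w assume v: "v \<in> tangent p" and w: "w \<in> tangent p"
  show "c *\<^sub>R phi_endo p (v + w) = c *\<^sub>R phi_endo p v + c *\<^sub>R phi_endo p w"
    using v w by (simp add: phi_endo_def tangent_closed matrix_mult_linear_simps phi_alg_linear_simps scaleR_add_right)
next
  fix d v assume v: "v \<in> tangent p"
  show "c *\<^sub>R phi_endo p v \<in> tangent p"
    using v by (simp add: phi_endo_def tangent_closed tangent_linv phi_alg_u_alg)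
  show "c *\<^sub>R phi_endo p (d *\<^sub>R v) = d *\<^sub>R c *\<^sub>R phi_endo p v"
    using v by (simp add: phi_endo_def tangent_closed matrix_mult_linear_simps phi_alg_linear_simps)
qed (simp add: phi_endo_def)

lemma endo_exp_phi_endo:
  assumes p: "p \<in> U2" and w: "w \<in> u_alg"
  shows "endo_exp (\<lambda>v. t *\<^sub>R c *\<^sub>R phi_endo p v) (p ** w) = p ** phi_rot (t * c) w"
proof -
  let ?A = "\<lambda>v. c *\<^sub>R phi_endo p v"
  have u: "(phi_alg ^^ n) w \<in> u_alg" for n by (cases n) (simp_all add: w phi_alg_u_alg)
  have pow: "(?A ^^ n) (p ** w) = p ** (c ^ n *\<^sub>R (phi_alg ^^ n) w)" for n
  proof (induction n)
    case (Suc n)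
    show ?case
      using phi_endo_linv[OF p u_alg_closed(4)[OF u[of n]], of "c ^ n"]
      by (simp add: Suc phi_alg_linear_simps matrix_mult_linear_simps)
  qed simp
  have "(\<lambda>n. p ** (((t * c) ^ n / fact n) *\<^sub>R (phi_alg ^^ n) w)) sums (p ** phi_rot (t * c) w)"
    by (rule bounded_linear.sums[OF
          bounded_bilinear.bounded_linear_right[OF bounded_bilinear_matrix_mult] phi_alg_exp_sums])
  moreover have "(\<lambda>n. p ** (((t * c) ^ n / fact n) *\<^sub>R (phi_alg ^^ n) w))
      = (\<lambda>n. (t ^ n / fact n) *\<^sub>R (?A ^^ n) (p ** w))"
    by (simp add: pow matrix_mult_linear_simps power_mult_distrib)
  ultimately have "(\<lambda>n. (t ^ n / fact n) *\<^sub>R (?A ^^ n) (p ** w)) sums (p ** phi_rot (t * c) w)" by simp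
  then show ?thesis
    using endo_exp_sums[OF p phi_endo_endo[OF p] tangent_linv[OF w]] sums_unique2 by blast
qed

context skew_torsion_connection
begin

text \<open>The one-parameter group of \<open>A\<close> preserves the quadratic form and the components along \<open>xi1\<close> and \<open>xi2\<close>, by
the invariants of parallel transport; taking the derivative at zero gives linear conditions on \<open>A\<close>.\<close>

lemma holonomy_algebra_subset:
  assumes p: "p \<in> U2" and A: "A \<in> holonomy_algebra nabla p"
  obtains c where "A = (\<lambda>v. c *\<^sub>R phi_endo p v)"
proof -
  have E: "A \<in> endo p" using A by (simp add: holonomy_algebra_def)
  have tA: "A v \<in> tangent p" "A (v + w) = A v + A w" if "v \<in> tangent p" "w \<in> tangent p" for v w
    using E that by (simp_all add: endo_def)
  define e where "e v t = herm_adj p ** endo_exp (\<lambda>v. t *\<^sub>R A v) v" for v t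
  define a where "a w = herm_adj p ** A (p ** w)" for w
  have inv: "ip_e (e v t) (e v t) = ip_e (herm_adj p ** v) (herm_adj p ** v)"
      "ip_e xi1 (e v t) = ip_e xi1 (herm_adj p ** v)" "ip_e xi2 (e v t) = ip_e xi2 (herm_adj p ** v)"
    if v: "v \<in> tangent p" for v t
  proof -
    have "endo_exp (\<lambda>v. t *\<^sub>R A v) \<in> holonomy_group nabla p"
      using A by (simp add: holonomy_algebra_def)
    then obtain \<gamma> V where loop: "loop_at p \<gamma>" and V: "parallel_along nabla \<gamma> V" "V 0 = v"
      "V 1 = endo_exp (\<lambda>v. t *\<^sub>R A v) v"
      using v unfolding holonomy_group_def by blast
    have "\<gamma> 0 = p" "\<gamma> 1 = p" using loop by (simp_all add: loop_at_def)
    then show "ip_e (e v t) (e v t) = ip_e (herm_adj p ** v) (herm_adj p ** v)"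
      "ip_e xi1 (e v t) = ip_e xi1 (herm_adj p ** v)" "ip_e xi2 (e v t) = ip_e xi2 (herm_adj p ** v)"
      using parallel_transport_invariants[OF loop V(1)] by (simp_all add: V e_def)
  qed
  have e: "(e v has_vector_derivative herm_adj p ** A v) (at 0)" "e v 0 = herm_adj p ** v"
    if v: "v \<in> tangent p" for v
    using bounded_linear.has_vector_derivative[OF
        bounded_bilinear.bounded_linear_right[OF bounded_bilinear_matrix_mult, of "herm_adj p"]
        endo_exp_has_vector_derivative[OF p E v]] endo_exp_zero[OF p E v]
    by (simp_all add: e_def[abs_def])
  have a: "a w \<in> u_alg" "ip_e w (a w) = 0" "ip_e xi1 (a w) = 0" "ip_e xi2 (a w) = 0" if w: "w \<in> u_alg" for w
  proof -
    note v = tangent_linv[OF w, of p]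
    note e' = e(1)[OF v]
    show "a w \<in> u_alg" using tA(1)[OF v v] by (simp add: a_def tangent_iff[OF p])
    have "((\<lambda>t. ip_e (e (p ** w) t) (e (p ** w) t)) has_vector_derivative
        ip_e w (a w) + ip_e (a w) w) (at 0)"
      using bounded_bilinear.has_vector_derivative[OF bounded_bilinear_ip_e e' e']
      by (simp add: e(2)[OF v] a_def U2_cancel[OF p])
    then have "((\<lambda>t. ip_e w w) has_vector_derivative ip_e w (a w) + ip_e (a w) w) (at (0::real))"
      by (simp add: inv(1)[OF v] U2_cancel[OF p])
    from vector_derivative_unique_at[OF this has_vector_derivative_const]
    show "ip_e w (a w) = 0" by (simp add: ip_e_commute[of "a w"])
    have xi: "ip_e \<xi> (a w) = 0" if "\<And>t. ip_e \<xi> (e (p ** w) t) = ip_e \<xi> w" for \<xi>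
    proof -
      have "((\<lambda>t. ip_e \<xi> w) has_vector_derivative ip_e \<xi> (a w)) (at (0::real))"
        using bounded_linear.has_vector_derivative[OF
            bounded_bilinear.bounded_linear_right[OF bounded_bilinear_ip_e, of \<xi>] e']
        by (simp add: that a_def)
      from vector_derivative_unique_at[OF this has_vector_derivative_const] show ?thesis .
    qed
    show "ip_e xi1 (a w) = 0" "ip_e xi2 (a w) = 0"
      by (rule xi, simp add: inv[OF v] U2_cancel[OF p])+
  qed
  have add: "a (v + w) = a v + a w" if "v \<in> u_alg" "w \<in> u_alg" for v w
    using tA(2)[OF tangent_linv[OF that(1), of p] tangent_linv[OF that(2)]]
    by (simp add: a_def matrix_mult_linear_simps)
  obtain c where c: "\<And>w. w \<in> u_alg \<Longrightarrow> a w = c *\<^sub>R phi_alg w"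
    using skew_vertical_eq_phi_alg[OF a(1) add a(2,3,4)] by blast
  have "A v = c *\<^sub>R phi_endo p v" for v
  proof (cases "v \<in> tangent p")
    case True
    then obtain w where w: "w \<in> u_alg" "v = p ** w" by (rule tangentE)
    have "A v = p ** a w" by (simp add: a_def w(2) U2_cancel[OF p])
    then show ?thesis by (simp add: c w phi_endo_linv[OF p] matrix_mult_linear_simps)
  next
    case False
    then show ?thesis using E by (simp add: endo_def phi_endo_def)
  qed
  then show thesis using that by blast
qed

lemma holonomy_algebra_eq:
  assumes p: "p \<in> U2"
  shows "holonomy_algebra nabla p = range (\<lambda>c v. c *\<^sub>R phi_endo p v)"
proof
  show "holonomy_algebra nabla p \<subseteq> range (\<lambda>c v. c *\<^sub>R phi_endo p v)"
    using holonomy_algebra_subset[OF p] by blast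
  have "endo_exp (\<lambda>v. t *\<^sub>R c *\<^sub>R phi_endo p v) \<in> holonomy_group nabla p" for t c
    using rotation_in_holonomy_group[OF p endo_exp_phi_endo[OF p]] .
  then show "range (\<lambda>c v. c *\<^sub>R phi_endo p v) \<subseteq> holonomy_algebra nabla p"
    using phi_endo_endo[OF p] by (auto simp: holonomy_algebra_def)
qed

end

text \<open>On two lines the commutators vanish, so any linear bijection is an isomorphism of Lie algebras.\<close>

lemma lie_isomorphic_one_dimensional:
  fixes M :: "'k::real_normed_field^'n^'n"
  assumes H: "H = range (\<lambda>(c::real) v. c *\<^sub>R T v)" and L: "L = range (\<lambda>c::real. c *\<^sub>R M)"
    and T: "T u \<noteq> 0" "\<And>c v. T (c *\<^sub>R T v) = c *\<^sub>R T (T v)" and M: "M \<noteq> 0"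
  shows "lie_isomorphic H L"
proof -
  have inj: "(\<lambda>v. c *\<^sub>R T v) = (\<lambda>v. d *\<^sub>R T v) \<longleftrightarrow> c = d" for c d :: real
  proof
    assume "(\<lambda>v. c *\<^sub>R T v) = (\<lambda>v. d *\<^sub>R T v)"
    then have "c *\<^sub>R T u = d *\<^sub>R T u" by (rule fun_cong)
    then show "c = d" using T(1) by simp
  qed simp
  define \<Phi> where "\<Phi> h = (THE c. h = (\<lambda>v. c *\<^sub>R T v)) *\<^sub>R M" for h
  have \<Phi>: "\<Phi> (\<lambda>v. c *\<^sub>R T v) = c *\<^sub>R M" for c by (simp add: \<Phi>_def inj)
  have sum: "(\<lambda>v. c *\<^sub>R T v + d *\<^sub>R T v) = (\<lambda>v. (c + d) *\<^sub>R T v)" for c d by (simp add: scaleR_add_left)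
  have comm: "(\<lambda>v. c *\<^sub>R T (d *\<^sub>R T v) - d *\<^sub>R T (c *\<^sub>R T v)) = (\<lambda>v. 0 *\<^sub>R T v)" for c d
    by (simp add: T(2) mult.commute)
  have scale: "(\<lambda>v. c *\<^sub>R d *\<^sub>R T v) = (\<lambda>v. (c * d) *\<^sub>R T v)" for c d by simp
  have MM: "(c *\<^sub>R M) ** (d *\<^sub>R M) = (d *\<^sub>R M) ** (c *\<^sub>R M)" for c d
    by (simp add: vec_eq_iff matrix_matrix_mult_def mult.commute)
  have bij: "bij_betw \<Phi> H L"
    using M by (intro bij_betwI[where g="\<lambda>B v. (THE c. B = c *\<^sub>R M) *\<^sub>R T v"]) (auto simp: H L \<Phi>)
  have elem: "\<exists>c. A = (\<lambda>v. c *\<^sub>R T v)" if "A \<in> H" for A using that unfolding H by blast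
  have pair: "(\<lambda>v. A v + B v) \<in> H \<and> (\<lambda>v. A (B v) - B (A v)) \<in> H"
    "\<Phi> (\<lambda>v. A v + B v) = \<Phi> A + \<Phi> B"
    "\<Phi> (\<lambda>v. A (B v) - B (A v)) = \<Phi> A ** \<Phi> B - \<Phi> B ** \<Phi> A" if AB: "A \<in> H" "B \<in> H" for A B
  proof -
    obtain c d where A: "A = (\<lambda>v. c *\<^sub>R T v)" and B: "B = (\<lambda>v. d *\<^sub>R T v)"
      using elem[OF AB(1)] elem[OF AB(2)] by blast
    show "(\<lambda>v. A v + B v) \<in> H \<and> (\<lambda>v. A (B v) - B (A v)) \<in> H"
      unfolding A B sum comm unfolding H by blast
    show "\<Phi> (\<lambda>v. A v + B v) = \<Phi> A + \<Phi> B" unfolding A B sum \<Phi> by (simp add: scaleR_add_left)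
    show "\<Phi> (\<lambda>v. A (B v) - B (A v)) = \<Phi> A ** \<Phi> B - \<Phi> B ** \<Phi> A"
      unfolding A B comm \<Phi> MM[of c d] by simp
  qed
  have scaled: "(\<lambda>v. c *\<^sub>R A v) \<in> H" "\<Phi> (\<lambda>v. c *\<^sub>R A v) = c *\<^sub>R \<Phi> A" if A: "A \<in> H" for A and c :: real
  proof -
    obtain d where A: "A = (\<lambda>v. d *\<^sub>R T v)" using elem[OF A] by blast
    show "(\<lambda>v. c *\<^sub>R A v) \<in> H" unfolding A scale unfolding H by blast
    show "\<Phi> (\<lambda>v. c *\<^sub>R A v) = c *\<^sub>R \<Phi> A" unfolding A scale \<Phi> by simp
  qed
  show ?thesis
    unfolding lie_isomorphic_def
    by (rule conjI, intro ballI, rule pair(1), assumption, assumption,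
        rule conjI, intro allI ballI, rule scaled(1), assumption,
        rule exI[of _ \<Phi>], intro conjI ballI allI bij pair(2,3) scaled(2))
qed

lemma so_alg_2: "(so_alg :: (real^2^2) set)
  = range (\<lambda>c. c *\<^sub>R (\<chi> i j. if i = j then 0 else if i = 1 then 1 else - 1))"
proof -
  have "A = A $ 1 $ 2 *\<^sub>R (\<chi> i j. if i = j then 0 else if i = 1 then 1 else - 1)"
    if "A \<in> so_alg" for A :: "real^2^2"
  proof -
    have "transpose A $ i $ j = - A $ i $ j" for i j using that by (simp add: so_alg_def)
    from this[of 1 1] this[of 2 2] this[of 1 2]
    have "A $ 1 $ 1 = 0" "A $ 2 $ 2 = 0" "A $ 2 $ 1 = - A $ 1 $ 2"
      unfolding transpose_def vec_lambda_beta vector_uminus_component by linarith+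
    then show ?thesis by (simp add: mat2_eq_iff)
  qed
  moreover have "c *\<^sub>R (\<chi> i j. if i = j then 0 else if i = 1 then 1 else - 1) \<in> (so_alg :: (real^2^2) set)" for c
    by (simp add: so_alg_def transpose_def mat2_eq_iff)
  ultimately show ?thesis by blast
qed

lemma u_alg_1: "(u_alg :: (complex^1^1) set) = range (\<lambda>c. c *\<^sub>R (\<chi> i j. \<i>))"
proof -
  have "A = Im (A $ 1 $ 1) *\<^sub>R (\<chi> i j. \<i>)" if "A \<in> u_alg" for A :: "complex^1^1"
  proof -
    have "cnj (A $ 1 $ 1) = - A $ 1 $ 1" using that by (simp add: u_alg_def herm_adj_def vec_eq_iff)
    then have "Re (A $ 1 $ 1) = 0" by (simp add: complex_eq_iff)
    then show ?thesis by (simp add: vec_eq_iff complex_eq_iff)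
  qed
  moreover have "c *\<^sub>R (\<chi> i j. \<i>) \<in> (u_alg :: (complex^1^1) set)" for c
    by (simp add: u_alg_def herm_adj_def vec_eq_iff)
  ultimately show ?thesis by blast
qed

theorem theorem5p6:
  fixes nablaG nabla :: "(mat2 \<Rightarrow> mat2) \<Rightarrow> (mat2 \<Rightarrow> mat2) \<Rightarrow> mat2 \<Rightarrow> mat2"
  assumes "levi_civita nablaG"
    and "affine_connection nabla"
    and "\<And>X Y Z p. vector_field X \<Longrightarrow> vector_field Y \<Longrightarrow> vector_field Z \<Longrightarrow> p \<in> U2 \<Longrightarrow>
      lmetric p (nabla X Y p) (Z p)
        = lmetric p (nablaG X Y p) (Z p) + 1 / 2 * torsion_form p (X p) (Y p) (Z p)"
  shows "(\<forall>p\<in>U2. lie_isomorphic (holonomy_algebra nabla p) (so_alg :: (real^2^2) set) \<and>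
                 lie_isomorphic (holonomy_algebra nabla p) (u_alg :: (complex^1^1) set)) \<and>
    parallel_curvature nabla"
proof -
  interpret skew_torsion_connection nablaG nabla
    using assms by unfold_locales
  have "lie_isomorphic (holonomy_algebra nabla p) (so_alg :: (real^2^2) set)"
    "lie_isomorphic (holonomy_algebra nabla p) (u_alg :: (complex^1^1) set)" if p: "p \<in> U2" for p
  proof -
    have "phi_endo p (p ** X12) = p ** Y12"
      using p frame_u_alg(1) by (simp add: phi_endo_linv phi_alg_def ip_e_def)
    moreover have "p ** Y12 \<noteq> 0"
    proof
      assume "p ** Y12 = 0"
      then have "Y12 = 0" using U2_cancel(1)[OF p, of Y12] by (simp add: matrix_mult_zero_right)
      then show False by (simp add: mat2_eq_iff)
    qed
    ultimately have nz: "phi_endo p (p ** X12) \<noteq> 0" by simp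
    have lin: "phi_endo p (c *\<^sub>R phi_endo p v) = c *\<^sub>R phi_endo p (phi_endo p v)" for c v
    proof -
      have E: "phi_endo p \<in> endo p" using phi_endo_endo[OF p, of 1] by simp
      have "phi_alg 0 = 0" by (simp add: phi_alg_def ip_e_def)
      then have "phi_endo p 0 = 0" by (simp add: phi_endo_def matrix_mult_zero_right)
      moreover have "phi_endo p v \<in> tangent p \<or> phi_endo p v = 0" using E by (auto simp: endo_def)
      ultimately show ?thesis using E by (auto simp: endo_def)
    qed
    show "lie_isomorphic (holonomy_algebra nabla p) (so_alg :: (real^2^2) set)"
      by (rule lie_isomorphic_one_dimensional[OF holonomy_algebra_eq[OF p] so_alg_2 nz lin])
        (simp add: mat2_eq_iff)
    show "lie_isomorphic (holonomy_algebra nabla p) (u_alg :: (complex^1^1) set)"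
      by (rule lie_isomorphic_one_dimensional[OF holonomy_algebra_eq[OF p] u_alg_1 nz lin])
        (simp add: vec_eq_iff)
  qed
  then show ?thesis using parallel_curvature by blast
qed

end
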